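(* (i) Let $d\le 5$ and let $\rho:\mathcal{B}_3\to \mathrm{GL}_d(\mathbb{C})$ be an irreducible representation of the braid group $\mathcal{B}_3$. Then there exists an extension of $\rho$ to the loop braid group $\mathcal{LB}_3$. (ii) For $d=6$, there is an irreducible representation $\rho:\mathcal{B}_3\to \mathrm{GL}_6(\mathbb{C})$ that has no extension to $\mathcal{LB}_3$.
   Context: $\mathcal{B}_3=\langle \sigma_1,\sigma_2 : \sigma_1\sigma_2\sigma_1=\sigma_2\sigma_1\sigma_2\rangle$ is the braid group. The three component loop braid group $\mathcal{LB}_3$ is the group generated by $\sigma_1,\sigma_2,s_1,s_2$ with relations $\sigma_1\sigma_2\sigma_1=\sigma_2\sigma_1\sigma_2$; $s_1s_2s_1=s_2s_1s_2$; $s_1^2=s_2^2=1$; $s_1s_2\sigma_1=\sigma_2s_1s_2$; $\sigma_1\sigma_2s_1=s_2\sigma_1\sigma_2$. An extension of a representation $\rho$ of $\mathcal{B}_3$ on $V$ to $\mathcal{LB}_3$ is a representation $\rho'$ of $\mathcal{LB}_3$ on the same space $V$ with $\rho'(\sigma_i)=\rho(\sigma_i)$ for $i=1,2$. *)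

theory Defs
  imports "HOL-Analysis.Analysis" "HOL-Algebra.Group"
begin

section \<open>Groups given by generators and relations\<close>

text \<open>The letter \<open>(a, True)\<close> stands for the generator \<open>a\<close> and \<open>(a, False)\<close> for its
  formal inverse. A pair \<open>(u, v)\<close> in \<open>R\<close> stands for the relation \<open>u = v\<close>.\<close>

type_synonym 'a gword = "('a \<times> bool) list"

inductive pres_eq :: "('a gword \<times> 'a gword) set \<Rightarrow> 'a gword \<Rightarrow> 'a gword \<Rightarrow> bool"
  for R :: "('a gword \<times> 'a gword) set" where
  refl: "pres_eq R u u"
| sym: "pres_eq R u v \<Longrightarrow> pres_eq R v u"
| trans: "pres_eq R u v \<Longrightarrow> pres_eq R v w \<Longrightarrow> pres_eq R u w"
| relation: "(u, v) \<in> R \<Longrightarrow> pres_eq R (x @ u @ y) (x @ v @ y)"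
| cancel: "pres_eq R (x @ [(a, b), (a, \<not> b)] @ y) (x @ y)"

definition pres_class :: "('a gword \<times> 'a gword) set \<Rightarrow> 'a gword \<Rightarrow> 'a gword set" where
  "pres_class R u = {v. pres_eq R u v}"

definition presented_group :: "('a gword \<times> 'a gword) set \<Rightarrow> 'a gword set monoid" where
  "presented_group R =
     \<lparr>carrier = range (pres_class R),
      mult = (\<lambda>X Y. \<Union>u\<in>X. \<Union>v\<in>Y. pres_class R (u @ v)),
      one = pres_class R []\<rparr>"

abbreviation gen :: "'a \<Rightarrow> 'a gword" where
  "gen a \<equiv> [(a, True)]"

lemma pres_eq_context:
  "pres_eq R u v \<Longrightarrow> pres_eq R (x @ u @ y) (x @ v @ y)"
proof (induction rule: pres_eq.induct)
  case (relation u v x' y')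
  then show ?case
    using pres_eq.relation[of u v R "x @ x'" "y' @ y"] by simp
next
  case (cancel x' a b y')
  then show ?case
    using pres_eq.cancel[of R "x @ x'" a b "y' @ y"] by simp
next
  case (trans u v w)
  then show ?case by (metis pres_eq.trans)
next
  case (sym u v)
  then show ?case by (metis pres_eq.sym)
next
  case (refl u)
  then show ?case by (metis pres_eq.refl)
qed

lemma pres_eq_append:
  assumes "pres_eq R u u'" "pres_eq R v v'"
  shows "pres_eq R (u @ v) (u' @ v')"
proof (rule pres_eq.trans)
  show "pres_eq R (u @ v) (u' @ v)"
    using pres_eq_context[OF assms(1), of "[]" v] by simp
  show "pres_eq R (u' @ v) (u' @ v')"
    using pres_eq_context[OF assms(2), of u' "[]"] by simp
qed

lemma pres_class_eq_iff: "pres_class R u = pres_class R v \<longleftrightarrow> pres_eq R u v"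
proof
  assume "pres_class R u = pres_class R v"
  then have "v \<in> pres_class R u"
    by (simp add: pres_class_def pres_eq.refl)
  then show "pres_eq R u v"
    by (simp add: pres_class_def)
next
  assume "pres_eq R u v"
  then show "pres_class R u = pres_class R v"
    using pres_eq.trans[of R u v] pres_eq.trans[OF pres_eq.sym, of R u v]
    by (auto simp: pres_class_def)
qed

lemma presented_group_mult:
  "pres_class R u \<otimes>\<^bsub>presented_group R\<^esub> pres_class R v = pres_class R (u @ v)"
proof -
  have eq: "pres_class R (u' @ v') = pres_class R (u @ v)"
    if "u' \<in> pres_class R u" "v' \<in> pres_class R v" for u' v'
    unfolding pres_class_eq_iff using that
    by (intro pres_eq_append) (simp_all add: pres_class_def pres_eq.sym)
  have ne: "u \<in> pres_class R u" "v \<in> pres_class R v"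
    by (simp_all add: pres_class_def pres_eq.refl)
  have "(\<Union>u'\<in>pres_class R u. \<Union>v'\<in>pres_class R v. pres_class R (u' @ v')) = pres_class R (u @ v)"
    using eq ne by blast
  then show ?thesis
    by (simp add: presented_group_def)
qed

lemma pres_eq_left_inverse:
  "pres_eq R (rev (map (\<lambda>(a, b). (a, \<not> b)) u) @ u) []"
proof (induction u)
  case (Cons c u)
  obtain a b where c: "c = (a, b)" by fastforce
  let ?i = "rev (map (\<lambda>(a, b). (a, \<not> b)) u)"
  have "pres_eq R (?i @ [(a, \<not> b), (a, \<not> \<not> b)] @ u) []"
    by (rule pres_eq.trans[OF pres_eq.cancel Cons.IH])
  then show ?case
    by (simp add: c)
qed (simp add: pres_eq.refl)

lemma group_presented_group: "group (presented_group R)"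
proof (rule groupI)
  fix X assume "X \<in> carrier (presented_group R)"
  then obtain u where X: "X = pres_class R u"
    by (auto simp: presented_group_def)
  have one: "\<one>\<^bsub>presented_group R\<^esub> = pres_class R []"
    by (simp add: presented_group_def)
  show "\<one>\<^bsub>presented_group R\<^esub> \<otimes>\<^bsub>presented_group R\<^esub> X = X"
    by (simp add: X one presented_group_mult)
  show "\<exists>Y\<in>carrier (presented_group R). Y \<otimes>\<^bsub>presented_group R\<^esub> X = \<one>\<^bsub>presented_group R\<^esub>"
  proof
    let ?Y = "pres_class R (rev (map (\<lambda>(a, b). (a, \<not> b)) u))"
    show "?Y \<in> carrier (presented_group R)"
      by (simp add: presented_group_def)
    show "?Y \<otimes>\<^bsub>presented_group R\<^esub> X = \<one>\<^bsub>presented_group R\<^esub>"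
      by (simp add: X one presented_group_mult pres_class_eq_iff pres_eq_left_inverse)
  qed
next
  fix X Y Z
  assume "X \<in> carrier (presented_group R)" "Y \<in> carrier (presented_group R)"
    "Z \<in> carrier (presented_group R)"
  then obtain u v w where "X = pres_class R u" "Y = pres_class R v" "Z = pres_class R w"
    by (auto simp: presented_group_def)
  then show "X \<otimes>\<^bsub>presented_group R\<^esub> Y \<otimes>\<^bsub>presented_group R\<^esub> Z
      = X \<otimes>\<^bsub>presented_group R\<^esub> (Y \<otimes>\<^bsub>presented_group R\<^esub> Z)"
    by (simp add: presented_group_mult)
next
  fix X Y
  assume "X \<in> carrier (presented_group R)" "Y \<in> carrier (presented_group R)"
  then obtain u v where "X = pres_class R u" "Y = pres_class R v"
    by (auto simp: presented_group_def)
  then show "X \<otimes>\<^bsub>presented_group R\<^esub> Y \<in> carrier (presented_group R)"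
    by (simp add: presented_group_mult) (simp add: presented_group_def)
next
  show "\<one>\<^bsub>presented_group R\<^esub> \<in> carrier (presented_group R)"
    by (simp add: presented_group_def)
qed

section \<open>The braid group and the loop braid group on three strands\<close>

datatype braid_gen = BSigma1 | BSigma2

definition braid_rels :: "(braid_gen gword \<times> braid_gen gword) set" where
  "braid_rels =
     {(gen BSigma1 @ gen BSigma2 @ gen BSigma1, gen BSigma2 @ gen BSigma1 @ gen BSigma2)}"

definition B3 :: "braid_gen gword set monoid" where
  "B3 = presented_group braid_rels"

definition B3_gen :: "braid_gen \<Rightarrow> braid_gen gword set" where
  "B3_gen a = pres_class braid_rels (gen a)"

datatype loop_gen = LSigma1 | LSigma2 | LS1 | LS2

definition loop_rels :: "(loop_gen gword \<times> loop_gen gword) set" where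
  "loop_rels =
     {(gen LSigma1 @ gen LSigma2 @ gen LSigma1, gen LSigma2 @ gen LSigma1 @ gen LSigma2),
      (gen LS1 @ gen LS2 @ gen LS1, gen LS2 @ gen LS1 @ gen LS2),
      (gen LS1 @ gen LS1, []),
      (gen LS2 @ gen LS2, []),
      (gen LS1 @ gen LS2 @ gen LSigma1, gen LSigma2 @ gen LS1 @ gen LS2),
      (gen LSigma1 @ gen LSigma2 @ gen LS1, gen LS2 @ gen LSigma1 @ gen LSigma2)}"

definition LB3 :: "loop_gen gword set monoid" where
  "LB3 = presented_group loop_rels"

definition LB3_gen :: "loop_gen \<Rightarrow> loop_gen gword set" where
  "LB3_gen a = pres_class loop_rels (gen a)"

section \<open>Matrix representations\<close>

definition GL :: "(complex ^ 'n ^ 'n) monoid" where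
  "GL = \<lparr>carrier = {A. invertible A}, mult = (**), one = mat 1\<rparr>"

lemma group_GL: "group (GL :: (complex ^ 'n ^ 'n) monoid)"
proof (rule groupI)
  fix A :: "complex ^ 'n ^ 'n"
  assume "A \<in> carrier GL"
  then obtain A' where "A ** A' = mat 1" "A' ** A = mat 1"
    by (auto simp: GL_def invertible_def)
  moreover from this have "invertible A'"
    unfolding invertible_def by blast
  ultimately show "\<exists>B\<in>carrier GL. B \<otimes>\<^bsub>GL\<^esub> A = \<one>\<^bsub>GL\<^esub>"
    by (intro bexI[of _ A']) (simp_all add: GL_def)
next
  show "\<one>\<^bsub>GL\<^esub> \<in> carrier (GL :: (complex ^ 'n ^ 'n) monoid)"
    unfolding GL_def invertible_def using matrix_mul_lid[of "mat 1 :: complex ^ 'n ^ 'n"]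
    by (simp del: matrix_mul_lid)
qed (simp_all add: GL_def invertible_mult matrix_mul_assoc)

definition representation :: "('g, 'm) monoid_scheme \<Rightarrow> ('g \<Rightarrow> complex ^ 'n ^ 'n) \<Rightarrow> bool" where
  "representation G \<rho> \<longleftrightarrow> \<rho> \<in> hom G GL"

text \<open>The space \<open>complex ^ 'n\<close> is never zero, so irreducibility needs no separate nonzero
  condition.\<close>

definition irreducible_rep :: "('g, 'm) monoid_scheme \<Rightarrow> ('g \<Rightarrow> complex ^ 'n ^ 'n) \<Rightarrow> bool" where
  "irreducible_rep G \<rho> \<longleftrightarrow> representation G \<rho> \<and>
     (\<forall>W. vec.subspace W \<and> (\<forall>g\<in>carrier G. \<forall>w\<in>W. \<rho> g *v w \<in> W) \<longrightarrow> W = {0} \<or> W = UNIV)"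

definition is_extension ::
  "(braid_gen gword set \<Rightarrow> complex ^ 'n ^ 'n) \<Rightarrow> (loop_gen gword set \<Rightarrow> complex ^ 'n ^ 'n) \<Rightarrow> bool"
  where
  "is_extension \<rho> \<rho>' \<longleftrightarrow> representation LB3 \<rho>' \<and>
     \<rho>' (LB3_gen LSigma1) = \<rho> (B3_gen BSigma1) \<and>
     \<rho>' (LB3_gen LSigma2) = \<rho> (B3_gen BSigma2)"

end

(* Schur's lemma makes (AB)^3 = (ABA)^2 scalar for an irreducible pair A = rho(sigma_1),
   B = rho(sigma_2), so a multiple D of C = AB satisfies D^3 = 1. An involution S with
   S D S = D^(-1) yields an extension s_1 = S, s_2 = D S D^(-1), because then s_1 s_2 = D. It exists
   when D has the same multiplicity at both primitive cube roots of unity. Eigenspaces of AB and of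
   ABA meet trivially when n > 1, and ABA has an eigenspace of dimension at least n/2, so all three
   multiplicities of D are at most n/2; for n <= 5 two of them agree, and rescaling D by a cube root
   of unity moves the remaining one to the eigenvalue 1.

   In dimension 6 the multiplicities can be 3, 2, 1. For such a pair of monomial matrices and a
   hypothetical extension, Z = C^(-1) s_1 s_2 commutes with A, which forces Z to be a multiple of 1
   or of A^2; then s_1 s_2 = C Z contradicts (s_1 s_2)^3 = 1 and
   trace (s_1 s_2) = trace (s_2 s_1) = trace ((s_1 s_2)^2). *)

theory Submission
  imports Defs "HOL-Computational_Algebra.Fundamental_Theorem_Algebra"
begin

section \<open>Representations of presented groups\<close>

definition word_value :: "('g, 'm) monoid_scheme \<Rightarrow> ('a \<Rightarrow> 'g) \<Rightarrow> 'a gword \<Rightarrow> 'g" where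
  "word_value G f w = foldr (\<lambda>(a, b) x. (if b then f a else inv\<^bsub>G\<^esub> f a) \<otimes>\<^bsub>G\<^esub> x) w \<one>\<^bsub>G\<^esub>"

lemma word_value_Nil [simp]: "word_value G f [] = \<one>\<^bsub>G\<^esub>"
  and word_value_Cons [simp]:
    "word_value G f ((a, b) # w) = (if b then f a else inv\<^bsub>G\<^esub> f a) \<otimes>\<^bsub>G\<^esub> word_value G f w"
  by (simp_all add: word_value_def)

context
  fixes G :: "('g, 'm) monoid_scheme" (structure) and f :: "'a \<Rightarrow> 'g"
  assumes G: "group G" and f: "\<And>a. f a \<in> carrier G"
begin

interpretation group G by (rule G)

lemma word_value_closed [simp]: "word_value G f w \<in> carrier G"
  by (induction w) (auto simp: f)

lemma word_value_append: "word_value G f (u @ v) = word_value G f u \<otimes> word_value G f v"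
  by (induction u) (auto simp: f m_assoc)

lemma word_value_pres_eq:
  assumes "pres_eq R u v" and "\<And>u v. (u, v) \<in> R \<Longrightarrow> word_value G f u = word_value G f v"
  shows "word_value G f u = word_value G f v"
  using assms(1)
proof (induction rule: pres_eq.induct)
  case (cancel x a b y)
  have "f a \<otimes> (inv f a \<otimes> z) = z" "inv f a \<otimes> (f a \<otimes> z) = z" if "z \<in> carrier G" for z
    using that by (simp_all add: f flip: m_assoc)
  then show ?case
    by (simp add: word_value_append)
qed (simp_all add: word_value_append assms(2))

text \<open>The universal property of a presentation: by \<open>word_value_pres_eq\<close> the value
  of a word depends only on its class, so evaluating an arbitrary representative is well
  defined.\<close>

lemma presented_group_hom_exists:
  assumes "\<And>u v. (u, v) \<in> R \<Longrightarrow> word_value G f u = word_value G f v"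
  shows "\<exists>\<phi>\<in>hom (presented_group R) G. \<forall>a. \<phi> (pres_class R (gen a)) = f a"
proof (intro bexI allI)
  define \<phi> where "\<phi> X = word_value G f (SOME w. w \<in> X)" for X
  have \<phi>: "\<phi> (pres_class R u) = word_value G f u" for u
  proof -
    have "(SOME w. w \<in> pres_class R u) \<in> pres_class R u"
      by (rule someI [of _ u]) (simp add: pres_class_def pres_eq.refl)
    then show ?thesis
      using word_value_pres_eq assms by (simp add: \<phi>_def pres_class_def)
  qed
  have carr: "carrier (presented_group R) = range (pres_class R)"
    by (simp add: presented_group_def)
  show "\<phi> \<in> hom (presented_group R) G"
    by (auto simp: hom_def carr presented_group_mult \<phi> word_value_append)
  show "\<phi> (pres_class R (gen a)) = f a" for a
    by (simp add: \<phi> f)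
qed

end

text \<open>A homomorphism is determined by its values on the generators. The letter
  \<open>(a, False)\<close> goes to the inverse because it cancels against \<open>(a, True)\<close>
  in the presented group.\<close>

lemma hom_presented_group_word:
  assumes G: "group G" and \<phi>: "\<phi> \<in> hom (presented_group R) G"
  shows "\<phi> (pres_class R w) = word_value G (\<lambda>a. \<phi> (pres_class R (gen a))) w"
proof -
  interpret group_hom "presented_group R" G \<phi>
    using assms group_presented_group by (simp add: group_hom_def group_hom_axioms_def)
  have carr [simp]: "pres_class R u \<in> carrier (presented_group R)" for u
    by (simp add: presented_group_def)
  have inv: "pres_class R [(a, False)] = inv\<^bsub>presented_group R\<^esub> pres_class R (gen a)" for a
  proof (rule group.inv_equality [OF group_presented_group, symmetric])
    show "pres_class R [(a, False)] \<otimes>\<^bsub>presented_group R\<^esub> pres_class R (gen a)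
        = \<one>\<^bsub>presented_group R\<^esub>"
      using pres_eq.cancel [of R "[]" a False "[]"]
      by (simp add: presented_group_mult pres_class_eq_iff) (simp add: presented_group_def pres_class_eq_iff)
  qed simp_all
  show ?thesis
  proof (induction w)
    case Nil
    then show ?case
      using hom_one by (simp add: presented_group_def)
  next
    case (Cons c w)
    obtain a b where c: "c = (a, b)" by fastforce
    have "pres_class R (c # w) = pres_class R [c] \<otimes>\<^bsub>presented_group R\<^esub> pres_class R w"
      by (simp add: presented_group_mult)
    moreover have "\<phi> (pres_class R [c])
        = (if b then \<phi> (pres_class R (gen a)) else inv\<^bsub>G\<^esub> \<phi> (pres_class R (gen a)))"
      using inv by (simp add: c)
    ultimately show ?case
      using Cons by (simp add: c)
  qed
qed

section \<open>Representations as matrices satisfying the relations\<close>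

lemma GL_simps [simp]:
  "M \<in> carrier GL \<longleftrightarrow> invertible M" "M \<otimes>\<^bsub>GL\<^esub> N = M ** N" "\<one>\<^bsub>GL\<^esub> = mat 1"
  by (simp_all add: GL_def)

lemma representation_B3_exists:
  fixes A B :: "complex ^ 'n ^ 'n"
  assumes "invertible A" "invertible B" "A ** (B ** A) = B ** (A ** B)"
  obtains \<rho> where "representation B3 \<rho>" "\<rho> (B3_gen BSigma1) = A" "\<rho> (B3_gen BSigma2) = B"
proof -
  let ?f = "case_braid_gen A B"
  have "?f a \<in> carrier GL" for a
    using assms by (cases a) auto
  moreover have "word_value GL ?f u = word_value GL ?f v" if "(u, v) \<in> braid_rels" for u v
    using that assms by (auto simp: braid_rels_def)
  ultimately obtain \<rho> where "\<rho> \<in> hom (presented_group braid_rels) GL"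
    and "\<And>a. \<rho> (pres_class braid_rels (gen a)) = ?f a"
    using presented_group_hom_exists [OF group_GL, of ?f braid_rels] by blast
  then show ?thesis
    by (intro that [of \<rho>]) (simp_all add: representation_def B3_def B3_gen_def)
qed

lemma representation_B3_relations:
  fixes \<rho> :: "braid_gen gword set \<Rightarrow> complex ^ 'n ^ 'n"
  assumes "representation B3 \<rho>"
  defines "A \<equiv> \<rho> (B3_gen BSigma1)" and "B \<equiv> \<rho> (B3_gen BSigma2)"
  shows "invertible A" "invertible B" "A ** (B ** A) = B ** (A ** B)"
proof -
  have hom: "\<rho> \<in> hom (presented_group braid_rels) GL"
    using assms by (simp add: representation_def B3_def)
  have "invertible (\<rho> (B3_gen a))" for a
    using hom_in_carrier [OF hom, of "B3_gen a"] by (simp add: B3_gen_def presented_group_def)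
  then show "invertible A" "invertible B"
    unfolding A_def B_def by simp_all
  have "pres_eq braid_rels (gen BSigma1 @ gen BSigma2 @ gen BSigma1)
          (gen BSigma2 @ gen BSigma1 @ gen BSigma2)"
    using pres_eq.relation [of "gen BSigma1 @ gen BSigma2 @ gen BSigma1"
        "gen BSigma2 @ gen BSigma1 @ gen BSigma2" braid_rels "[]" "[]"]
    by (simp add: braid_rels_def)
  then have "\<rho> (pres_class braid_rels (gen BSigma1 @ gen BSigma2 @ gen BSigma1))
      = \<rho> (pres_class braid_rels (gen BSigma2 @ gen BSigma1 @ gen BSigma2))"
    by (metis pres_class_eq_iff)
  then show "A ** (B ** A) = B ** (A ** B)"
    by (simp add: hom_presented_group_word [OF group_GL hom, folded B3_gen_def] A_def B_def)
qed

text \<open>Turns extensions into a matrix problem: \<open>S\<close> and \<open>T\<close> are the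
  images of \<open>LS1\<close> and \<open>LS2\<close>, the other two images are prescribed, and
  their braid relation is inherited from \<open>\<rho>\<close>.\<close>

lemma extension_exists_iff:
  fixes \<rho> :: "braid_gen gword set \<Rightarrow> complex ^ 'n ^ 'n"
  assumes \<rho>: "representation B3 \<rho>"
  defines "A \<equiv> \<rho> (B3_gen BSigma1)" and "B \<equiv> \<rho> (B3_gen BSigma2)"
  shows "(\<exists>\<rho>'. is_extension \<rho> \<rho>') \<longleftrightarrow>
    (\<exists>S T. S ** S = mat 1 \<and> T ** T = mat 1 \<and> S ** (T ** S) = T ** (S ** T) \<and>
       S ** (T ** A) = B ** (S ** T) \<and> A ** (B ** S) = T ** (A ** B))" (is "?L \<longleftrightarrow> ?R")
proof
  assume ?L
  then obtain \<rho>' where ext: "is_extension \<rho> \<rho>'" by blast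
  then have hom: "\<rho>' \<in> hom (presented_group loop_rels) GL"
    by (simp add: is_extension_def representation_def LB3_def)
  have rel: "\<rho>' (pres_class loop_rels u) = \<rho>' (pres_class loop_rels v)" if "(u, v) \<in> loop_rels" for u v
  proof -
    have "pres_eq loop_rels u v"
      using pres_eq.relation [OF that, of "[]" "[]"] by simp
    then show ?thesis
      by (metis pres_class_eq_iff)
  qed
  have word: "\<rho>' (pres_class loop_rels w) = word_value GL (\<lambda>a. \<rho>' (LB3_gen a)) w" for w
    unfolding LB3_gen_def by (rule hom_presented_group_word [OF group_GL hom])
  have AB: "\<rho>' (LB3_gen LSigma1) = A" "\<rho>' (LB3_gen LSigma2) = B"
    using ext by (simp_all add: is_extension_def A_def B_def)
  show ?R
  proof (intro exI conjI)
    let ?S = "\<rho>' (LB3_gen LS1)" and ?T = "\<rho>' (LB3_gen LS2)"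
    have rel': "word_value GL (\<lambda>a. \<rho>' (LB3_gen a)) u = word_value GL (\<lambda>a. \<rho>' (LB3_gen a)) v"
      if "(u, v) \<in> loop_rels" for u v
      using rel [OF that] by (simp only: word)
    show "?S ** ?S = mat 1"
      using rel' [of "gen LS1 @ gen LS1" "[]"] by (simp add: loop_rels_def)
    show "?T ** ?T = mat 1"
      using rel' [of "gen LS2 @ gen LS2" "[]"] by (simp add: loop_rels_def)
    show "?S ** (?T ** ?S) = ?T ** (?S ** ?T)"
      using rel' [of "gen LS1 @ gen LS2 @ gen LS1" "gen LS2 @ gen LS1 @ gen LS2"]
      by (simp add: loop_rels_def)
    show "?S ** (?T ** A) = B ** (?S ** ?T)"
      using rel' [of "gen LS1 @ gen LS2 @ gen LSigma1" "gen LSigma2 @ gen LS1 @ gen LS2"]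
      by (simp add: loop_rels_def AB)
    show "A ** (B ** ?S) = ?T ** (A ** B)"
      using rel' [of "gen LSigma1 @ gen LSigma2 @ gen LS1" "gen LS2 @ gen LSigma1 @ gen LSigma2"]
      by (simp add: loop_rels_def AB)
  qed
next
  assume ?R
  then obtain S T where rels: "S ** S = mat 1" "T ** T = mat 1" "S ** (T ** S) = T ** (S ** T)"
    "S ** (T ** A) = B ** (S ** T)" "A ** (B ** S) = T ** (A ** B)"
    by blast
  let ?f = "case_loop_gen A B S T"
  have "invertible S" "invertible T"
    using rels(1,2) unfolding invertible_def by blast+
  then have "?f a \<in> carrier GL" for a
    using representation_B3_relations [OF \<rho>] by (cases a) (auto simp: A_def B_def)
  moreover have "word_value GL ?f u = word_value GL ?f v" if "(u, v) \<in> loop_rels" for u v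
    using that unfolding loop_rels_def
    by (elim insertE emptyE Pair_inject; hypsubst;
      simp add: rels representation_B3_relations [OF \<rho>, folded A_def B_def])
  ultimately obtain \<rho>' where "\<rho>' \<in> hom (presented_group loop_rels) GL"
    and "\<And>a. \<rho>' (pres_class loop_rels (gen a)) = ?f a"
    using presented_group_hom_exists [OF group_GL, of ?f loop_rels] by blast
  then have "is_extension \<rho> \<rho>'"
    by (simp add: is_extension_def representation_def LB3_def LB3_gen_def A_def B_def)
  then show ?L by blast
qed

section \<open>Irreducibility in terms of the two generators\<close>

lemma inverse_matrix_invariant_subspace:
  fixes A A' :: "'a::field ^ 'n ^ 'n"
  assumes W: "vec.subspace W" and inv: "\<And>w. w \<in> W \<Longrightarrow> A *v w \<in> W" and A': "A' ** A = mat 1"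
    and w: "w \<in> W"
  shows "A' *v w \<in> W"
proof -
  have left: "A' *v (A *v x) = x" for x
    unfolding matrix_vector_mul_assoc A' by (rule matrix_vector_mul_lid)
  have "inj_on ((*v) A) (vec.span W)"
    by (rule inj_on_inverseI [where g = "(*v) A'"]) (rule left)
  then have "vec.dim ((*v) A ` W) = vec.dim W"
    by (rule vec.dim_image_eq [OF matrix_vector_mul_linear_gen])
  then have "vec.dim W \<le> vec.dim ((*v) A ` W)"
    by (simp only: order_refl)
  moreover have "(*v) A ` W \<subseteq> W"
    using inv by (rule image_subsetI)
  \<comment> \<open>Since \<open>A\<close> is injective, the image of \<open>W\<close> has the
    dimension of \<open>W\<close>; lying inside \<open>W\<close>, it is all of
    \<open>W\<close>.\<close>
  ultimately have "(*v) A ` W = W"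
    by (intro vec.subspace_dim_equal [OF vec.subspace_image [OF W] W])
  with w have "w \<in> (*v) A ` W"
    by (simp only:)
  then obtain x where "w = A *v x" "x \<in> W"
    by (rule imageE)
  then show ?thesis
    by (simp only: left)
qed

text \<open>Words contain formal inverses, while invariance is assumed under the generators only;
  finite dimension carries it over to the inverses.\<close>

lemma representation_B3_invariant_subspace:
  fixes \<rho> :: "braid_gen gword set \<Rightarrow> complex ^ 'n ^ 'n"
  assumes \<rho>: "representation B3 \<rho>" and W: "vec.subspace W" and g: "g \<in> carrier B3"
    and inv: "\<And>a w. w \<in> W \<Longrightarrow> \<rho> (B3_gen a) *v w \<in> W"
  shows "w \<in> W \<Longrightarrow> \<rho> g *v w \<in> W"
proof -
  have hom: "\<rho> \<in> hom (presented_group braid_rels) GL"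
    using \<rho> by (simp add: representation_def B3_def)
  have carr: "\<rho> (B3_gen a) \<in> carrier GL" for a
    using hom_in_carrier [OF hom, of "B3_gen a"] by (simp add: B3_gen_def presented_group_def)
  obtain u where u: "g = pres_class braid_rels u"
    using g by (auto simp: B3_def presented_group_def)
  have "word_value GL (\<lambda>a. \<rho> (B3_gen a)) u *v w \<in> W" if "w \<in> W" for w u
    using that
  proof (induction u)
    case (Cons c u)
    obtain a b where c: "c = (a, b)" by fastforce
    have "inv\<^bsub>GL\<^esub> (\<rho> (B3_gen a)) ** \<rho> (B3_gen a) = mat 1"
      using group.l_inv [OF group_GL carr] by (simp only: GL_simps)
    from inverse_matrix_invariant_subspace [OF W inv this] show ?case
      using Cons inv by (auto simp: c matrix_vector_mul_assoc [symmetric])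
  qed simp
  then show "w \<in> W \<Longrightarrow> \<rho> g *v w \<in> W"
    by (simp add: u hom_presented_group_word [OF group_GL hom, folded B3_gen_def])
qed

text \<open>Irreducibility phrased without the group, so that Schur's lemma and the eigenspace
  bounds can be proved for plain matrices.\<close>

definition irreducible_pair :: "'a::field ^ 'n ^ 'n \<Rightarrow> 'a ^ 'n ^ 'n \<Rightarrow> bool" where
  "irreducible_pair A B \<longleftrightarrow>
    (\<forall>W. vec.subspace W \<and> (\<forall>w\<in>W. A *v w \<in> W \<and> B *v w \<in> W) \<longrightarrow> W = {0} \<or> W = UNIV)"

lemma irreducible_rep_B3_iff:
  fixes \<rho> :: "braid_gen gword set \<Rightarrow> complex ^ 'n ^ 'n"
  assumes "representation B3 \<rho>"
  shows "irreducible_rep B3 \<rho> \<longleftrightarrow> irreducible_pair (\<rho> (B3_gen BSigma1)) (\<rho> (B3_gen BSigma2))"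
proof -
  have gen: "B3_gen a \<in> carrier B3" for a
    by (simp add: B3_gen_def B3_def presented_group_def)
  have "(\<forall>g\<in>carrier B3. \<forall>w\<in>W. \<rho> g *v w \<in> W) \<longleftrightarrow>
      (\<forall>w\<in>W. \<rho> (B3_gen BSigma1) *v w \<in> W \<and> \<rho> (B3_gen BSigma2) *v w \<in> W)"
    if "vec.subspace W" for W :: "(complex ^ 'n) set"
  proof
    assume *: "\<forall>w\<in>W. \<rho> (B3_gen BSigma1) *v w \<in> W \<and> \<rho> (B3_gen BSigma2) *v w \<in> W"
    then have "\<rho> (B3_gen a) *v w \<in> W" if "w \<in> W" for a w
      using that by (cases a) auto
    then show "\<forall>g\<in>carrier B3. \<forall>w\<in>W. \<rho> g *v w \<in> W"
      using representation_B3_invariant_subspace [OF assms \<open>vec.subspace W\<close>] by blast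
  next
    assume "\<forall>g\<in>carrier B3. \<forall>w\<in>W. \<rho> g *v w \<in> W"
    then show "\<forall>w\<in>W. \<rho> (B3_gen BSigma1) *v w \<in> W \<and> \<rho> (B3_gen BSigma2) *v w \<in> W"
      using gen by simp
  qed
  then have "(vec.subspace W \<and> (\<forall>g\<in>carrier B3. \<forall>w\<in>W. \<rho> g *v w \<in> W)) =
      (vec.subspace W \<and>
        (\<forall>w\<in>W. \<rho> (B3_gen BSigma1) *v w \<in> W \<and> \<rho> (B3_gen BSigma2) *v w \<in> W))" for W
    by (rule conj_cong [OF HOL.refl])
  then show ?thesis
    by (simp add: irreducible_rep_def irreducible_pair_def assms)
qed

section \<open>Eigenvectors\<close>

lemma mat_mult_vector [simp]: "mat k *v x = k *s (x :: 'a::comm_semiring_1 ^ 'n)"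
  by (simp add: vec_eq_iff matrix_vector_mult_def mat_def if_distrib if_distribR cong: if_cong)

lemma mat_mult_left: "mat k ** M = (\<chi> i j. k * M $ i $ j)"
  for M :: "'a::comm_semiring_1 ^ 'n ^ 'm"
  by (simp add: vec_eq_iff matrix_matrix_mult_def mat_def if_distrib if_distribR cong: if_cong)

lemma mat_commute: "M ** mat k = mat k ** M"
  for M :: "'a::comm_semiring_1 ^ 'n ^ 'm"
  by (simp add: mat_mult_left)
     (simp add: vec_eq_iff matrix_matrix_mult_def mat_def if_distrib if_distribR mult.commute cong: if_cong)

lemma mat_mult_mat: "mat k ** mat l = (mat (k * l) :: 'a::comm_semiring_1 ^ 'n ^ 'n)"
  by (simp add: mat_mult_left) (simp add: vec_eq_iff mat_def)

lemma poly_det: "poly (det P) x = det (\<chi> i j. poly (P $ i $ j) x)"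
  for P :: "'a::comm_ring_1 poly ^ 'n ^ 'n"
  by (simp add: det_def poly_sum poly_prod)

text \<open>If the characteristic polynomial had no root, it would be a constant \<open>c\<close>, and comparing
  \<open>det (1 - y M)\<close> with \<open>c * det y\<close> at \<open>y = 0\<close> would give \<open>1 = 0\<close>.\<close>

lemma eigenvector_exists:
  fixes M :: "complex ^ 'n ^ 'n"
  obtains c v where "v \<noteq> 0" "M *v v = c *s v"
proof -
  define p where "p = det (\<chi> i j. (if i = j then [:0, 1:] else 0) - [:M $ i $ j:])"
  define q where "q = det (\<chi> i j. (if i = j then 1 else 0) - [:0, M $ i $ j:])"
  define r where "r = det (\<chi> i j. if i = j then [:0, 1 :: complex:] else 0 :: complex poly ^ 'n ^ 'n)"
  have p: "poly p z = det (mat z - M)" for z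
    unfolding p_def poly_det by (rule arg_cong [where f = det]) (simp add: vec_eq_iff mat_def)
  have q: "poly q z = det (mat 1 - mat z ** M)" for z
    unfolding q_def poly_det mat_mult_left
    by (rule arg_cong [where f = det]) (simp add: vec_eq_iff mat_def)
  have r: "poly r z = det (mat z :: complex ^ 'n ^ 'n)" for z
    unfolding r_def poly_det by (rule arg_cong [where f = det]) (simp add: vec_eq_iff mat_def)
  have "\<exists>z. poly p z = 0"
  proof (rule fundamental_theorem_of_algebra, rule notI)
    assume "constant (poly p)"
    then have const: "poly p z = poly p 0" for z
      by (auto simp: constant_def)
    have "poly (q - smult (poly p 0) r) z = 0" if "z \<noteq> 0" for z
    proof -
      have "mat 1 - mat z ** M = mat z ** (mat (1 / z) - M)"
        unfolding mat_mult_left using that by (simp add: vec_eq_iff mat_def right_diff_distrib)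
      then have "poly q z = poly r z * poly p (1 / z)"
        by (simp add: p q r det_mul)
      then show ?thesis
        using const [of "1 / z"] by simp
    qed
    \<comment> \<open>A polynomial with infinitely many zeros is zero, so the comparison extends to
      \<open>z = 0\<close>, where the factorization above does not apply.\<close>
    then have "UNIV - {0} \<subseteq> {z. poly (q - smult (poly p 0) r) z = 0}"
      by blast
    moreover have "infinite (UNIV - {0 :: complex})"
      by (simp add: infinite_UNIV_char_0)
    ultimately have "infinite {z. poly (q - smult (poly p 0) r) z = 0}"
      using infinite_super by blast
    then have "q - smult (poly p 0) r = 0"
      using poly_roots_finite by blast
    then have "poly q 0 = poly p 0 * poly r 0"
      by simp
    moreover have "poly r 0 = 0"
      unfolding r by (rule det_0)
    moreover have "mat 0 ** M = 0"
      by (simp add: vec_eq_iff mat_mult_left)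
    then have "poly q 0 = 1"
      by (simp add: q)
    ultimately show False
      by simp
  qed
  then obtain z where "det (mat z - M) = 0"
    by (auto simp: p)
  then have "\<not> invertible (mat z - M)"
    using invertible_det_nz by blast
  then obtain v where "v \<noteq> 0" "(mat z - M) *v v = 0"
    unfolding invertible_left_inverse matrix_left_invertible_ker by blast
  then show ?thesis
    by (intro that [of v z]) (simp_all add: matrix_vector_mult_diff_rdistrib)
qed

definition eigenspace :: "'a::field ^ 'n ^ 'n \<Rightarrow> 'a \<Rightarrow> ('a ^ 'n) set" where
  "eigenspace M c = {v. M *v v = c *s v}"

lemma subspace_eigenspace [simp]: "vec.subspace (eigenspace M c)"
  unfolding vec.subspace_def eigenspace_def
proof (intro conjI ballI allI)
  fix x y k
  assume x: "x \<in> {v. M *v v = c *s v}"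
  show "k *s x \<in> {v. M *v v = c *s v}"
    using x by (simp add: vec.scale mult.commute)
  assume y: "y \<in> {v. M *v v = c *s v}"
  show "x + y \<in> {v. M *v v = c *s v}"
    using x y by (simp add: vec.add vector_add_ldistrib)
qed simp

lemma eigenspace_commute:
  assumes "M ** N = N ** M" "v \<in> eigenspace M c"
  shows "N *v v \<in> eigenspace M c"
proof -
  have "M *v (N *v v) = N *v (M *v v)"
    by (simp only: matrix_vector_mul_assoc assms(1))
  then show ?thesis
    using assms(2) unfolding eigenspace_def by (simp only: mem_Collect_eq vec.scale)
qed

lemma eigenspace_mat_mult: "k \<noteq> 0 \<Longrightarrow> eigenspace (mat k ** M) (k * c) = eigenspace M c"
  unfolding eigenspace_def matrix_vector_mul_assoc [symmetric]
  by (simp add: vec_eq_iff mult.assoc)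

text \<open>Schur's lemma: some eigenspace of \<open>M\<close> is nonzero, and it is invariant under
  both matrices, hence the whole space.\<close>

lemma commuting_matrix_scalar:
  fixes A B M :: "complex ^ 'n ^ 'n"
  assumes irr: "irreducible_pair A B"
    and comm: "M ** A = A ** M" "M ** B = B ** M"
  obtains c where "M = mat c"
proof -
  obtain c v where v: "v \<noteq> 0" "M *v v = c *s v"
    by (rule eigenvector_exists)
  have "eigenspace M c = {0} \<or> eigenspace M c = UNIV"
    using irr [unfolded irreducible_pair_def] subspace_eigenspace eigenspace_commute [OF comm(1)] eigenspace_commute [OF comm(2)]
    by blast
  then have "M *v x = c *s x" for x
    using v unfolding eigenspace_def by blast
  then have "M = mat c"
    by (simp add: matrix_eq)
  then show ?thesis
    by (rule that)
qed

section \<open>Dimensions of sums of two subspaces\<close>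

lemma dim_sum_ge:
  fixes S T :: "('a::field ^ 'n) set"
  assumes "vec.subspace S" "vec.subspace T" "\<And>v. \<exists>x\<in>S. \<exists>y\<in>T. v = x + y"
  shows "CARD('n) \<le> vec.dim S + vec.dim T"
proof -
  have "{x + y |x y. x \<in> S \<and> y \<in> T} = UNIV"
    using assms(3) by blast
  then have "vec.dim {x + y |x y. x \<in> S \<and> y \<in> T} = CARD('n)"
    by (simp only: vec_dim_card)
  then show ?thesis
    using vec.dim_sums_Int [OF assms(1,2)] by linarith
qed

lemma dim_disjoint_le:
  fixes S T :: "('a::field ^ 'n) set"
  assumes "vec.subspace S" "vec.subspace T" "S \<inter> T \<subseteq> {0}"
  shows "vec.dim S + vec.dim T \<le> CARD('n)"
proof -
  have "vec.dim (S \<inter> T) \<le> vec.dim {0 :: 'a ^ 'n}"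
    using assms(3) by (rule vec.dim_subset)
  then have "vec.dim (S \<inter> T) = 0"
    by (simp add: vec.dim_eq_0)
  then show ?thesis
    using vec.dim_sums_Int [OF assms(1,2)] dim_subset_UNIV_cart_gen [of "{x + y |x y. x \<in> S \<and> y \<in> T}"]
    by linarith
qed

lemma dim_sum_le:
  fixes S T :: "('a::field ^ 'n) set"
  assumes "vec.subspace S" "vec.subspace T"
  shows "vec.dim {x + y |x y. x \<in> S \<and> y \<in> T} \<le> vec.dim S + vec.dim T"
  using vec.dim_sums_Int [OF assms] by simp

section \<open>Inverting an operator of order three\<close>

lemma cube_root_of_unity_sum:
  fixes w :: "'a::idom"
  assumes "w ^ 3 = 1" "w \<noteq> 1"
  shows "1 + w + w\<^sup>2 = 0"
proof -
  have "(w - 1) * (1 + w + w\<^sup>2) = w ^ 3 - 1"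
    by (simp add: algebra_simps power2_eq_square power3_eq_cube)
  then show ?thesis
    using assms by simp
qed

text \<open>If the cube of \<open>D\<close> is the identity and \<open>c\<close> is a cube root of
  unity, this is (1 + D/c + (D/c)^2) / 3, the projection onto the eigenspace of \<open>c\<close>;
  the inverse powers of \<open>c\<close> are written as its square and \<open>c\<close>
  itself.\<close>

definition eigenprojection :: "complex ^ 'n ^ 'n \<Rightarrow> complex \<Rightarrow> complex ^ 'n ^ 'n" where
  "eigenprojection D c = mat (1 / 3) ** (mat 1 + mat (c\<^sup>2) ** D + mat c ** (D ** D))"

lemma eigenprojection_apply:
  "eigenprojection D c *v v = (1 / 3) *s (v + c\<^sup>2 *s (D *v v) + c *s (D *v (D *v v)))"
  by (simp add: eigenprojection_def matrix_vector_mult_add_rdistrib flip: matrix_vector_mul_assoc)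

text \<open>For cube roots of unity \<open>c\<close> and \<open>e\<close> the factor is (1 + t +
  t^2) / 3 with t = e/c, that is, 1 if \<open>e = c\<close> and 0 otherwise.\<close>

lemma eigenprojection_eigenspace:
  assumes "v \<in> eigenspace D e"
  shows "eigenprojection D c *v v = ((1 + c\<^sup>2 * e + c * e\<^sup>2) / 3) *s v"
  using assms
  by (simp add: eigenprojection_apply eigenspace_def vec.scale)
     (simp add: vec_eq_iff power2_eq_square algebra_simps add_divide_distrib)

context
  fixes D :: "complex ^ 'n ^ 'n" and w :: complex
  assumes D: "D ** (D ** D) = mat 1" and w: "w ^ 3 = 1" "w \<noteq> 1"
begin

lemma apply_D3: "D *v (D *v (D *v v)) = v"
  by (simp add: matrix_vector_mul_assoc D flip: matrix_mul_assoc)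

lemma eigenprojection_in_eigenspace:
  assumes "c ^ 3 = 1"
  shows "eigenprojection D c *v v \<in> eigenspace D c"
proof -
  have c: "c * (c * c) = 1" "c * (c * (c * x)) = x" for x
    using assms by (simp_all add: power3_eq_cube mult.assoc [symmetric])
  show ?thesis
    unfolding eigenspace_def mem_Collect_eq eigenprojection_apply
    by (simp only: vec.scale vec.add apply_D3)
       (simp add: vec_eq_iff distrib_left c power2_eq_square mult.left_commute)
qed

text \<open>Rewrite rules reducing polynomials in \<open>w\<close> to degree at most one; the second
  form catches products nested to the right.\<close>

lemma square_w: "w * w = - 1 - w" "w * (w * a) = (- 1 - w) * a"
proof -
  have "w * w = (1 + w + w\<^sup>2) - 1 - w"
    by (simp add: power2_eq_square)
  then show "w * w = - 1 - w"
    by (simp add: cube_root_of_unity_sum [OF w])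
  then show "w * (w * a) = (- 1 - w) * a"
    by (simp only: mult.assoc [symmetric])
qed

text \<open>The coefficients of \<open>D *v v\<close> and of \<open>D *v (D *v v)\<close> add up to
  multiples of 1 + w + w^2 = 0.\<close>

lemma eigenprojection_sum:
  "v = eigenprojection D 1 *v v + eigenprojection D w *v v + eigenprojection D (w\<^sup>2) *v v"
  unfolding eigenprojection_apply
  by (simp add: vec_eq_iff power2_eq_square square_w algebra_simps)

lemma eigenspace_decomposition:
  "\<exists>x\<in>eigenspace D 1. \<exists>y\<in>eigenspace D w. \<exists>z\<in>eigenspace D (w\<^sup>2). v = x + y + z"
proof -
  have "(w\<^sup>2) ^ 3 = (w ^ 3)\<^sup>2"
    by (simp only: power_mult [symmetric] mult.commute)
  then have "(w\<^sup>2) ^ 3 = 1"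
    by (simp only: w power_one)
  then show ?thesis
    using eigenprojection_sum [of v] eigenprojection_in_eigenspace [of 1 v]
      eigenprojection_in_eigenspace [OF w(1), of v] eigenprojection_in_eigenspace [of "w\<^sup>2" v]
    by (metis power_one)
qed

text \<open>The involution is the identity on the eigenspace of \<open>1\<close> and interchanges the other two.\<close>

lemma inverting_involution_exists:
  assumes dim: "vec.dim (eigenspace D w) = vec.dim (eigenspace D (w\<^sup>2))"
  obtains S where "S ** S = mat 1" "S ** (D ** S) = D ** D"
proof -
  let ?U = "eigenspace D"
  \<comment> \<open>Equal dimensions give an isomorphism \<open>f\<close> between the two
    eigenspaces; \<open>g\<close> below is a linear map on the whole space that inverts it.\<close>
  obtain f where f: "Vector_Spaces.linear (*s) (*s) f" "f ` ?U w = ?U (w\<^sup>2)" "inj_on f (?U w)"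
    using vec.subspace_isomorphism [OF subspace_eigenspace subspace_eigenspace dim]
    by (elim exE conjE) (rule that)
  obtain g where g: "g ` UNIV \<subseteq> ?U w" "Vector_Spaces.linear (*s) (*s) g" "\<forall>v\<in>?U w. g (f v) = v"
    using vec.linear_exists_left_inverse_on [OF f(1) subspace_eigenspace f(3)]
    by (elim exE conjE) (rule that)
  define F where "F = matrix f"
  define G where "G = matrix g"
  have F: "F *v v = f v" and G: "G *v v = g v" for v
    using matrix_works [OF f(1)] matrix_works [OF g(2)] by (simp_all add: F_def G_def)
  have F1: "F *v x \<in> ?U (w\<^sup>2)" "G *v (F *v x) = x" if "x \<in> ?U w" for x
  proof -
    have "f x \<in> ?U (w\<^sup>2)"
      unfolding f(2) [symmetric] by (rule imageI [OF that])
    then show "F *v x \<in> ?U (w\<^sup>2)" "G *v (F *v x) = x"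
      using bspec [OF g(3) that] by (simp_all only: F G)
  qed
  have G1: "G *v y \<in> ?U w" "F *v (G *v y) = y" if "y \<in> ?U (w\<^sup>2)" for y
  proof -
    have "y \<in> f ` ?U w"
      using that by (simp only: f(2))
    then obtain x where x: "y = f x" "x \<in> ?U w"
      by (rule imageE)
    show "G *v y \<in> ?U w" "F *v (G *v y) = y"
      using x bspec [OF g(3) x(2)] by (simp_all only: F G)
  qed
  define S where "S = eigenprojection D 1 + F ** eigenprojection D w + G ** eigenprojection D (w\<^sup>2)"
  have S: "S *v v = eigenprojection D 1 *v v + F *v (eigenprojection D w *v v)
      + G *v (eigenprojection D (w\<^sup>2) *v v)" for v
    by (simp add: S_def matrix_vector_mult_add_rdistrib matrix_vector_mul_assoc)
  \<comment> \<open>Each eigenprojection is 1 on its own eigenspace and 0 on the other two, so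
    \<open>S\<close> acts as the identity, \<open>F\<close> and \<open>G\<close> on the three
    summands.\<close>
  have S0: "S *v x = x" if "x \<in> ?U 1" for x
    by (simp add: S eigenprojection_eigenspace [OF that] power2_eq_square algebra_simps square_w)
  have Sw: "S *v x = F *v x" if "x \<in> ?U w" for x
    by (simp add: S eigenprojection_eigenspace [OF that] power2_eq_square algebra_simps square_w)
  have Sw2: "S *v x = G *v x" if "x \<in> ?U (w\<^sup>2)" for x
    by (simp add: S eigenprojection_eigenspace [OF that] power2_eq_square algebra_simps square_w)
  \<comment> \<open>By linearity both identities can be checked on the summands. On the two that
    \<open>S\<close> interchanges, \<open>S ** (D ** S)\<close> replaces the eigenvalue w by w^2 and
    w^2 by w, exactly as squaring \<open>D\<close> does.\<close>
  have "(S ** S) *v v = mat 1 *v v \<and> (S ** (D ** S)) *v v = (D ** D) *v v" for v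
  proof -
    obtain x y z where x: "x \<in> ?U 1" and y: "y \<in> ?U w" and z: "z \<in> ?U (w\<^sup>2)" and v: "v = x + y + z"
      using eigenspace_decomposition by blast
    have D': "D *v x = x" "D *v y = w *s y" "D *v z = w\<^sup>2 *s z"
      "D *v (F *v y) = w\<^sup>2 *s (F *v y)" "D *v (G *v z) = w *s (G *v z)"
      using x y z F1(1) [OF y] G1(1) [OF z] unfolding eigenspace_def by simp_all
    have S': "S *v x = x" "S *v y = F *v y" "S *v z = G *v z"
      "S *v (F *v y) = y" "S *v (G *v z) = z"
      using S0 [OF x] Sw [OF y] Sw2 [OF z] Sw2 [OF F1(1) [OF y]] Sw [OF G1(1) [OF z]]
      by (simp_all only: F1(2) [OF y] G1(2) [OF z])
    show ?thesis
      unfolding matrix_vector_mul_assoc [symmetric] v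
      by (simp add: vec.add vec.scale D' S' power2_eq_square)
         (simp add: vec_eq_iff algebra_simps square_w)
  qed
  then show ?thesis
    by (intro that [of S]) (simp_all only: matrix_eq simp_thms)
qed

end

section \<open>Eigenspace dimensions for irreducible representations\<close>

context
  fixes A B :: "complex ^ 'n ^ 'n"
  assumes inv: "invertible A" "invertible B" and braid: "A ** (B ** A) = B ** (A ** B)"
    and irr: "irreducible_pair A B"
begin

text \<open>Regroup the six factors as (ABA)(BAB) and apply the braid relation to the second half.
  The element is the full twist, which is central in the braid group.\<close>

lemma AB_cubed_eq_ABA_squared:
  "(A ** B) ** ((A ** B) ** (A ** B)) = (A ** (B ** A)) ** (A ** (B ** A))"
proof -
  have "(A ** B) ** ((A ** B) ** (A ** B)) = (A ** (B ** A)) ** (B ** (A ** B))"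
    by (simp only: matrix_mul_assoc)
  then show ?thesis
    by (simp only: braid [symmetric])
qed

text \<open>ABA intertwines \<open>A\<close> with \<open>B\<close> in both directions, so its square
  commutes with both and Schur's lemma applies.\<close>

lemma ABA_squared_scalar:
  obtains l where "l \<noteq> 0" "(A ** (B ** A)) ** (A ** (B ** A)) = mat l"
proof -
  let ?E = "A ** (B ** A)"
  have EA: "?E ** A = B ** ?E"
    by (subst braid) (simp only: matrix_mul_assoc)
  have EB: "?E ** B = A ** ?E"
  proof -
    have "?E ** B = A ** (B ** (A ** B))"
      by (simp only: matrix_mul_assoc)
    then show ?thesis
      by (simp only: braid)
  qed
  have "?E ** ?E ** A = A ** (?E ** ?E)" "?E ** ?E ** B = B ** (?E ** ?E)"
    by (metis EA EB matrix_mul_assoc)+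
  then obtain l where l: "?E ** ?E = mat l"
    by (rule commuting_matrix_scalar [OF irr])
  have "invertible (?E ** ?E)"
    by (intro invertible_mult inv)
  then have "l \<noteq> 0"
    unfolding l invertible_det_nz by (metis det_0)
  then show ?thesis
    by (rule that) (rule l)
qed

text \<open>A common eigenvector of AB and ABA is an eigenvector of \<open>A\<close>, because AB is
  injective, and then also of \<open>B\<close>. It would span an invariant line.\<close>

lemma eigenspaces_ABA_AB_disjoint:
  assumes "CARD('n) \<noteq> 1"
  shows "eigenspace (A ** (B ** A)) e \<inter> eigenspace (A ** B) c \<subseteq> {0}"
proof
  fix v
  assume "v \<in> eigenspace (A ** (B ** A)) e \<inter> eigenspace (A ** B) c"
  then have E: "A *v (B *v (A *v v)) = e *s v" and C: "A *v (B *v v) = c *s v"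
    by (simp_all add: eigenspace_def matrix_vector_mul_assoc)
  have injA: "A *v x = A *v y \<Longrightarrow> x = y" and injB: "B *v x = B *v y \<Longrightarrow> x = y" for x y
    using inv unfolding invertible_left_inverse matrix_left_invertible_injective inj_def by blast+
  show "v \<in> {0}"
  proof (rule ccontr)
    assume "v \<notin> {0}"
    then have v: "v \<noteq> 0" by simp
    have "c \<noteq> 0"
    proof
      assume "c = 0"
      then have "A *v (B *v v) = A *v (B *v 0)"
        by (simp add: C)
      then show False
        using injA injB v by blast
    qed
    have "A *v (B *v (A *v v)) = A *v (B *v ((e / c) *s v))"
      using \<open>c \<noteq> 0\<close> by (simp add: E C vec.scale)
    then have Av: "A *v v = (e / c) *s v"
      using injA injB by blast
    have "e \<noteq> 0"
    proof
      assume "e = 0"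
      then have "A *v v = A *v 0"
        by (simp add: Av)
      then show False
        using injA v by blast
    qed
    have "A *v (B *v v) = A *v ((c * c / e) *s v)"
      using \<open>c \<noteq> 0\<close> \<open>e \<noteq> 0\<close> by (simp add: C Av vec.scale)
    then have Bv: "B *v v = (c * c / e) *s v"
      by (rule injA)
    have "vec.span {v} = {0} \<or> vec.span {v} = UNIV"
    proof (rule irr [unfolded irreducible_pair_def, rule_format], intro conjI ballI)
      fix x assume "x \<in> vec.span {v}"
      then obtain k where x: "x = k *s v"
        by (auto simp: vec.span_singleton)
      show "A *v x \<in> vec.span {v}" "B *v x \<in> vec.span {v}"
        by (simp_all add: x vec.scale Av Bv vec.span_scale vec.span_base)
    qed simp
    then have "vec.span {v} = UNIV"
      using v vec.span_base [of v "{v}"] by auto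
    then have "vec.dim (vec.span {v}) = CARD('n)"
      by (simp only: vec_dim_card)
    moreover have "vec.dim (vec.span {v}) = 1"
      using v by simp
    ultimately show False
      using assms by simp
  qed
qed

text \<open>The square of ABA is a nonzero scalar e^2, so its eigenspaces for e and -e span the
  space. Both meet the given eigenspace of AB trivially; adding the two dimension bounds produces
  the factor 2.\<close>

lemma eigenspace_AB_dim_le:
  assumes "CARD('n) \<noteq> 1"
  shows "2 * vec.dim (eigenspace (A ** B) c) \<le> CARD('n)"
proof -
  let ?E = "A ** (B ** A)"
  obtain l where l: "l \<noteq> 0" "?E ** ?E = mat l"
    by (rule ABA_squared_scalar)
  define e where "e = csqrt l"
  have e: "e * e = l" "e \<noteq> 0"
    using l power2_csqrt [of l] by (auto simp: e_def power2_eq_square)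
  have EE: "?E *v (?E *v v) = (e * e) *s v" for v
    unfolding matrix_vector_mul_assoc l e by (rule mat_mult_vector)
  have "CARD('n) \<le> vec.dim (eigenspace ?E e) + vec.dim (eigenspace ?E (- e))"
  proof (rule dim_sum_ge [OF subspace_eigenspace subspace_eigenspace], intro bexI)
    fix v
    \<comment> \<open>The components of \<open>v\<close> under the projections (1 + E/e)/2 and (1 -
      E/e)/2.\<close>
    let ?x = "(1 / 2) *s v + (1 / (2 * e)) *s (?E *v v)"
    let ?y = "(1 / 2) *s v + (- 1 / (2 * e)) *s (?E *v v)"
    show "v = ?x + ?y"
      by (simp add: vec_eq_iff)
    show "?x \<in> eigenspace ?E e"
      unfolding eigenspace_def mem_Collect_eq vec.add vec.scale EE
      using e(2) by (simp add: vec_eq_iff field_simps)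
    show "?y \<in> eigenspace ?E (- e)"
      unfolding eigenspace_def mem_Collect_eq vec.add vec.scale EE
      using e(2) by (simp add: vec_eq_iff field_simps)
  qed
  moreover have "vec.dim (eigenspace ?E k) + vec.dim (eigenspace (A ** B) c) \<le> CARD('n)" for k
    by (rule dim_disjoint_le [OF subspace_eigenspace subspace_eigenspace
        eigenspaces_ABA_AB_disjoint [OF assms]])
  from this [of e] this [of "- e"]
  have "vec.dim (eigenspace ?E e) + vec.dim (eigenspace (A ** B) c) \<le> CARD('n)"
    "vec.dim (eigenspace ?E (- e)) + vec.dim (eigenspace (A ** B) c) \<le> CARD('n)" .
  ultimately show ?thesis
    by linarith
qed

end

section \<open>Extensions in dimension at most five\<close>

text \<open>The cube root of unity exp(2 pi i / 3), in Cartesian form so that claims about explicit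
  values split into real and imaginary parts.\<close>

definition \<omega> :: complex where
  "\<omega> = Complex (- 1 / 2) (sqrt 3 / 2)"

lemma omega_square: "\<omega> * \<omega> = - 1 - \<omega>" "\<omega> * (\<omega> * z) = (- 1 - \<omega>) * z"
proof -
  show "\<omega> * \<omega> = - 1 - \<omega>"
    by (simp add: \<omega>_def complex_eq_iff)
  then show "\<omega> * (\<omega> * z) = (- 1 - \<omega>) * z"
    by (simp only: mult.assoc [symmetric])
qed

lemma omega_cubed: "\<omega> ^ 3 = 1"
  by (simp add: power3_eq_cube omega_square algebra_simps)

lemma omega_neq [simp]: "\<omega> \<noteq> 0" "\<omega> \<noteq> 1"
  by (simp_all add: \<omega>_def complex_eq_iff)

lemma mat_mult_cubed:
  fixes M :: "'a::comm_semiring_1 ^ 'n ^ 'n"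
  shows "(mat k ** M) ** ((mat k ** M) ** (mat k ** M)) = mat (k ^ 3) ** (M ** (M ** M))"
proof -
  have "(mat k ** M) ** ((mat k ** M) ** (mat k ** M))
      = mat k ** ((M ** mat k) ** ((M ** mat k) ** M))"
    by (simp only: matrix_mul_assoc)
  also have "\<dots> = mat k ** ((mat k ** M) ** ((mat k ** M) ** M))"
    by (simp only: mat_commute)
  also have "\<dots> = mat k ** (mat k ** ((M ** mat k) ** (M ** M)))"
    by (simp only: matrix_mul_assoc)
  also have "\<dots> = mat k ** (mat k ** ((mat k ** M) ** (M ** M)))"
    by (simp only: mat_commute)
  also have "\<dots> = (mat k ** (mat k ** mat k)) ** (M ** (M ** M))"
    by (simp only: matrix_mul_assoc)
  also have "mat k ** (mat k ** mat k) = (mat (k ^ 3) :: 'a ^ 'n ^ 'n)"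
    by (simp only: mat_mult_mat power3_eq_cube mult.assoc)
  finally show ?thesis .
qed

lemma sum_of_three_eigenspaces_dim_ge:
  fixes D :: "complex ^ 'n ^ 'n"
  assumes "D ** (D ** D) = mat 1" "w ^ 3 = 1" "w \<noteq> 1"
  shows "CARD('n) \<le> vec.dim (eigenspace D 1) + vec.dim (eigenspace D w) + vec.dim (eigenspace D (w\<^sup>2))"
proof -
  let ?U = "eigenspace D"
  let ?S = "{x + y |x y. x \<in> ?U 1 \<and> y \<in> ?U w}"
  have "CARD('n) \<le> vec.dim ?S + vec.dim (?U (w\<^sup>2))"
  proof (rule dim_sum_ge)
    show "vec.subspace ?S"
      by (intro vec.subspace_sums subspace_eigenspace)
    show "\<exists>x\<in>?S. \<exists>y\<in>?U (w\<^sup>2). v = x + y" for v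
      using eigenspace_decomposition [OF assms, of v] by blast
  qed simp
  moreover have "vec.dim ?S \<le> vec.dim (?U 1) + vec.dim (?U w)"
    by (intro dim_sum_le subspace_eigenspace)
  ultimately show ?thesis
    by linarith
qed

text \<open>For \<open>n \<noteq> 1\<close> all three numbers are at most 2. Distinct ones would be
  0, 1, 2 with sum 3, but the value 2 requires \<open>n\<close> to be at least 4. For
  \<open>n = 1\<close> the bounds leave only the values 0 and 1.\<close>

lemma two_of_three_equal:
  fixes a b c n :: nat
  assumes "n \<le> 5" "n \<le> a + b + c" "a \<le> n" "b \<le> n" "c \<le> n"
    "n \<noteq> 1 \<Longrightarrow> 2 * a \<le> n" "n \<noteq> 1 \<Longrightarrow> 2 * b \<le> n" "n \<noteq> 1 \<Longrightarrow> 2 * c \<le> n"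
  shows "b = c \<or> c = a \<or> a = b"
proof (cases "n = 1")
  case False
  then have "2 * a \<le> n" "2 * b \<le> n" "2 * c \<le> n"
    using assms by simp_all
  then show ?thesis
    using assms(1,2) by arith
qed (use assms(3-5) in arith)

text \<open>\<open>T\<close> is the conjugate of \<open>S\<close> by \<open>D\<close>, as
  \<open>D ** D\<close> inverts \<open>D\<close>. Then \<open>S ** T = D\<close>, and the mixed
  relations become \<open>D ** A = B ** D\<close>, a multiple of the braid relation, and
  \<open>T ** D = D ** S\<close>, true by construction.\<close>

lemma loop_matrices_of_inverting_involution:
  fixes A B S :: "'a::field ^ 'n ^ 'n"
  assumes braid: "A ** (B ** A) = B ** (A ** B)"
    and k: "k \<noteq> 0" and D: "D = mat k ** (A ** B)" "D ** (D ** D) = mat 1"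
    and S: "S ** S = mat 1" "S ** (D ** S) = D ** D"
  defines "T \<equiv> D ** (S ** (D ** D))"
  shows "T ** T = mat 1" "S ** (T ** S) = T ** (S ** T)"
    "S ** (T ** A) = B ** (S ** T)" "A ** (B ** S) = T ** (A ** B)"
proof -
  have D3: "D ** (D ** (D ** X)) = X" and S2: "S ** (S ** X) = X"
    and SDS: "S ** (D ** (S ** X)) = D ** (D ** X)" for X :: "'a ^ 'n ^ 'n"
    using arg_cong [OF D(2), of "\<lambda>Y. Y ** X"] arg_cong [OF S(1), of "\<lambda>Y. Y ** X"]
      arg_cong [OF S(2), of "\<lambda>Y. Y ** X"]
    by (simp_all only: matrix_mul_assoc [symmetric] matrix_mul_lid)
  have TX: "T ** X = D ** (S ** (D ** (D ** X)))" for X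
    by (simp only: T_def matrix_mul_assoc [symmetric])
  have ST: "S ** T = D"
    by (simp only: T_def SDS) (simp only: D3 D(2) matrix_mul_rid)
  show "T ** T = mat 1"
    unfolding TX unfolding T_def by (simp only: D3 S2 D(2))
  have TD: "T ** D = D ** S"
    unfolding TX by (simp only: D(2) matrix_mul_rid)
  show "S ** (T ** S) = T ** (S ** T)"
    unfolding ST TD by (simp only: matrix_mul_assoc ST)
  have C: "A ** B = mat (1 / k) ** D"
    using k unfolding D(1) matrix_mul_assoc mat_mult_mat by simp
  have "(A ** B) ** A = B ** (A ** B)"
    using braid by (simp only: matrix_mul_assoc)
  then have "mat k ** ((A ** B) ** A) = mat k ** B ** (A ** B)"
    by (simp only: matrix_mul_assoc)
  then have "D ** A = B ** D"
    unfolding D(1) by (simp only: mat_commute [symmetric, of k B] matrix_mul_assoc)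
  then show "S ** (T ** A) = B ** (S ** T)"
    unfolding ST by (simp only: matrix_mul_assoc ST)
  have "T ** (A ** B) = mat (1 / k) ** (T ** D)"
    unfolding C by (simp only: mat_commute [symmetric, of _ T] matrix_mul_assoc)
  then show "A ** (B ** S) = T ** (A ** B)"
    unfolding TD using C by (simp only: matrix_mul_assoc)
qed

lemma loop_matrices_exist:
  fixes A B :: "complex ^ 'n ^ 'n"
  assumes card: "CARD('n) \<le> 5"
    and inv: "invertible A" "invertible B" and braid: "A ** (B ** A) = B ** (A ** B)"
    and irr: "irreducible_pair A B"
  shows "\<exists>S T. S ** S = mat 1 \<and> T ** T = mat 1 \<and> S ** (T ** S) = T ** (S ** T) \<and>
       S ** (T ** A) = B ** (S ** T) \<and> A ** (B ** S) = T ** (A ** B)"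
proof -
  obtain l where l: "l \<noteq> 0" "(A ** (B ** A)) ** (A ** (B ** A)) = mat l"
    by (rule ABA_squared_scalar [OF inv braid irr])
  define m where "m = exp (Ln l / 3)"
  have "m ^ 3 = l"
    using l(1) by (simp add: m_def flip: exp_of_nat_mult)
  then have m: "m \<noteq> 0" "m ^ 3 = l"
    by (auto simp: m_def)
  have C3: "(A ** B) ** ((A ** B) ** (A ** B)) = mat l"
    unfolding AB_cubed_eq_ABA_squared [OF inv braid irr] by (rule l)
  \<comment> \<open>AB normalized to have cube 1. The cube root \<open>m\<close> of \<open>l\<close>
    is fixed only up to a cube root of unity, and \<open>c\<close> is that freedom.\<close>
  let ?D = "\<lambda>c. mat (1 / (m * c)) ** (A ** B)"
  have D3: "?D c ** (?D c ** ?D c) = mat 1" if "c ^ 3 = 1" for c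
    unfolding mat_mult_cubed C3 mat_mult_mat
    using that l m by (simp add: power_mult_distrib power_divide)
  have eig: "eigenspace (?D c) d = eigenspace (A ** B) (m * (c * d))" if "c \<noteq> 0" for c d
  proof -
    have k: "1 / (m * c) * (m * (c * d)) = d" "1 / (m * c) \<noteq> 0"
      using m(1) that by simp_all
    from eigenspace_mat_mult [OF k(2), of "A ** B" "m * (c * d)"] show ?thesis
      unfolding k(1) .
  qed
  let ?u = "\<lambda>d. vec.dim (eigenspace (A ** B) (m * d))"
  have "CARD('n) \<le> ?u 1 + ?u \<omega> + ?u (\<omega>\<^sup>2)"
    using sum_of_three_eigenspaces_dim_ge [OF D3 omega_cubed omega_neq(2), of 1]
    by (simp add: eig [of 1, simplified])
  then have "?u \<omega> = ?u (\<omega>\<^sup>2) \<or> ?u (\<omega>\<^sup>2) = ?u 1 \<or> ?u 1 = ?u \<omega>"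
    by (rule two_of_three_equal [OF card _ dim_subset_UNIV_cart_gen dim_subset_UNIV_cart_gen
          dim_subset_UNIV_cart_gen])
      (rule eigenspace_AB_dim_le [OF inv braid irr], assumption)+
  \<comment> \<open>\<open>m * c\<close> is taken to be the eigenvalue outside the pair with equal
    dimensions; dividing by it moves the pair to \<open>\<omega>\<close> and its square.\<close>
  then obtain c where c: "c ^ 3 = 1" "?u (c * \<omega>) = ?u (c * \<omega>\<^sup>2)"
  proof (elim disjE)
    assume "?u \<omega> = ?u (\<omega>\<^sup>2)"
    then show ?thesis
      by (intro that [of 1]) simp_all
  next
    assume "?u (\<omega>\<^sup>2) = ?u 1"
    moreover have "\<omega> * \<omega> = \<omega>\<^sup>2" "\<omega> * \<omega>\<^sup>2 = 1"
      by (simp_all add: power2_eq_square omega_square algebra_simps)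
    ultimately show ?thesis
      by (intro that [of \<omega>]) (simp_all only: omega_cubed)
  next
    assume "?u 1 = ?u \<omega>"
    moreover have "\<omega>\<^sup>2 * \<omega> = 1" "\<omega>\<^sup>2 * \<omega>\<^sup>2 = \<omega>" "(\<omega>\<^sup>2) ^ 3 = 1"
      by (simp_all add: power2_eq_square power3_eq_cube omega_square algebra_simps)
    ultimately show ?thesis
      by (intro that [of "\<omega>\<^sup>2"]) (simp_all only:)
  qed
  have c0: "c \<noteq> 0"
    using c(1) by auto
  have "vec.dim (eigenspace (?D c) \<omega>) = vec.dim (eigenspace (?D c) (\<omega>\<^sup>2))"
    unfolding eig [OF c0] by (rule c)
  then obtain S where S: "S ** S = mat 1" "S ** (?D c ** S) = ?D c ** ?D c"
    by (rule inverting_involution_exists [OF D3 [OF c(1)] omega_cubed omega_neq(2)])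
  have "1 / (m * c) \<noteq> 0"
    using m c0 by simp
  from loop_matrices_of_inverting_involution [OF braid this HOL.refl D3 [OF c(1)] S] S(1)
  show ?thesis
    by blast
qed

theorem extension_exists_of_dim_le_5:
  fixes \<rho> :: "braid_gen gword set \<Rightarrow> complex ^ 'n ^ 'n"
  assumes card: "CARD('n) \<le> 5" and irr: "irreducible_rep B3 \<rho>"
  shows "\<exists>\<rho>'. is_extension \<rho> \<rho>'"
proof -
  have rep: "representation B3 \<rho>"
    using irr by (simp add: irreducible_rep_def)
  from loop_matrices_exist [OF card representation_B3_relations [OF rep]
    irr [unfolded irreducible_rep_B3_iff [OF rep]]]
  show ?thesis
    unfolding extension_exists_iff [OF rep] by blast
qed

section \<open>Arithmetic modulo six on the index type\<close>

lemma numeral_6 [simp]: "6 = (0 :: 6)" "- 1 = (5 :: 6)"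
  by (simp_all add: eq_neg_iff_add_eq_0)

lemma exhaust_6: "x = 0 \<or> x = 1 \<or> x = 2 \<or> x = 3 \<or> x = 4 \<or> x = (5 :: 6)"
proof (induct x)
  case (of_int z)
  then have "z = 0 \<or> z = 1 \<or> z = 2 \<or> z = 3 \<or> z = 4 \<or> z = 5" by fastforce
  then show ?case by auto
qed

lemma forall_6: "(\<forall>i::6. P i) \<longleftrightarrow> P 0 \<and> P 1 \<and> P 2 \<and> P 3 \<and> P 4 \<and> P 5"
  by (metis exhaust_6)

lemma UNIV_6: "UNIV = {0, 1, 2, 3, 4, 5 :: 6}"
  using exhaust_6 by auto

lemma sum_6: "sum f (UNIV :: 6 set) = f 0 + f 1 + f 2 + f 3 + f 4 + f 5"
  unfolding UNIV_6 by (simp add: ac_simps)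

lemmas omega_simps = omega_square power2_eq_square

section \<open>Monomial matrices\<close>

text \<open>The matrix sends the basis vector e_j to \<open>c j\<close> times e_(p j). Products
  compose the index maps, so identities between such matrices become finite checks over the
  indices.\<close>

definition monomial_matrix :: "('n \<Rightarrow> 'n) \<Rightarrow> ('n \<Rightarrow> 'a::comm_semiring_1) \<Rightarrow> 'a ^ 'n ^ 'n" where
  "monomial_matrix p c = (\<chi> i j. if i = p j then c j else 0)"

lemma mult_monomial_matrix_nth: "(X ** monomial_matrix p c) $ i $ j = X $ i $ p j * c j"
proof -
  have "(X ** monomial_matrix p c) $ i $ j
      = (\<Sum>k\<in>UNIV. if k = p j then X $ i $ p j * c j else 0)"
    unfolding matrix_matrix_mult_def monomial_matrix_def vec_lambda_beta
    by (rule sum.cong) auto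
  then show ?thesis
    by simp
qed

lemma monomial_matrix_mult:
  "monomial_matrix p c ** monomial_matrix q d = monomial_matrix (\<lambda>j. p (q j)) (\<lambda>j. c (q j) * d j)"
  unfolding vec_eq_iff mult_monomial_matrix_nth
  unfolding monomial_matrix_def vec_lambda_beta by auto

lemma monomial_matrix_cong:
  "(\<forall>j. p j = q j \<and> c j = d j) \<Longrightarrow> monomial_matrix p c = monomial_matrix q d"
  by (simp add: vec_eq_iff monomial_matrix_def)

lemma mat_eq_monomial_matrix: "mat k = monomial_matrix (\<lambda>j. j) (\<lambda>j. k)"
  by (simp add: vec_eq_iff monomial_matrix_def mat_def)

lemma trace_monomial_matrix: "trace (monomial_matrix p c) = (\<Sum>j\<in>UNIV. if p j = j then c j else 0)"
  unfolding trace_def monomial_matrix_def vec_lambda_beta by (rule sum.cong) auto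

lemma monomial_matrix_vector_nth:
  assumes "inj p"
  shows "(monomial_matrix p c *v v) $ p i = c i * v $ i"
proof -
  have "(monomial_matrix p c *v v) $ p i = (\<Sum>k\<in>UNIV. if k = i then c i * v $ i else 0)"
    unfolding matrix_vector_mult_def monomial_matrix_def vec_lambda_beta inj_eq [OF assms]
    by (rule sum.cong) auto
  then show ?thesis
    by simp
qed

lemma monomial_matrix_mult_nth:
  assumes "inj p"
  shows "(monomial_matrix p c ** X) $ p i $ j = c i * X $ i $ j"
proof -
  have "(monomial_matrix p c ** X) $ p i $ j = (\<Sum>k\<in>UNIV. if k = i then c i * X $ i $ j else 0)"
    unfolding matrix_matrix_mult_def monomial_matrix_def vec_lambda_beta inj_eq [OF assms]
    by (rule sum.cong) auto
  then show ?thesis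
    by simp
qed

section \<open>A six-dimensional representation\<close>

text \<open>On the cyclic basis \<open>e\<^sub>j = A6\<^sup>j e\<^sub>0\<close>, the matrix \<open>C6 = A6 B6\<close> has order 3 and the
  eigenvalues \<open>1, \<omega>, \<omega>\<^sup>2\<close> with multiplicities 3, 2, 1.\<close>

definition A6 :: "complex ^ 6 ^ 6" where
  "A6 = monomial_matrix (\<lambda>j. j + 1) (\<lambda>j. if j = 5 then \<omega>\<^sup>2 else 1)"

definition B6 :: "complex ^ 6 ^ 6" where
  "B6 = monomial_matrix
     (\<lambda>j. if j = 0 then 3 else if j = 1 then 0 else if j = 2 then 5 else if j = 3 then 2
       else if j = 4 then 1 else 4)
     (\<lambda>j. if j = 4 then \<omega>\<^sup>2 else if j = 1 \<or> j = 5 then 1 else \<omega>)"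

text \<open>The cycle 0, 4, 2 has coefficient product 1 and contributes each cube root of unity
  once; the fixed indices 1, 5 and 3 add the eigenvalues 1, 1 and \<open>\<omega>\<close>. This
  gives the multiplicities 3, 2, 1.\<close>

definition C6 :: "complex ^ 6 ^ 6" where
  "C6 = monomial_matrix
     (\<lambda>j. if j = 0 then 4 else if j = 4 then 2 else if j = 2 then 0 else j)
     (\<lambda>j. if j = 0 \<or> j = 3 then \<omega> else if j = 4 then \<omega>\<^sup>2 else 1)"

lemma A6_B6: "A6 ** B6 = C6"
  unfolding A6_def B6_def C6_def monomial_matrix_mult
  by (rule monomial_matrix_cong) (simp add: forall_6 omega_simps algebra_simps)

lemma A6_B6_braid: "A6 ** (B6 ** A6) = B6 ** (A6 ** B6)"
  unfolding A6_def B6_def monomial_matrix_mult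
  by (rule monomial_matrix_cong) (simp add: forall_6 omega_simps algebra_simps)

lemma C6_cubed: "C6 ** (C6 ** C6) = mat 1"
  unfolding C6_def monomial_matrix_mult mat_eq_monomial_matrix
  by (rule monomial_matrix_cong) (simp add: forall_6 omega_simps algebra_simps)

lemma invertible_A6_B6: "invertible A6" "invertible B6"
proof -
  have "A6 ** (B6 ** (C6 ** C6)) = mat 1" "(C6 ** (C6 ** A6)) ** B6 = mat 1"
    by (metis A6_B6 C6_cubed matrix_mul_assoc)+
  then show "invertible A6" "invertible B6"
    unfolding invertible_right_inverse [of A6] invertible_left_inverse [of B6] by blast+
qed

section \<open>The six-dimensional representation has no extension\<close>

lemma C6_mult_nth:
  "(C6 ** X) $ 0 $ j = X $ 2 $ j" "(C6 ** X) $ 1 $ j = X $ 1 $ j"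
  "(C6 ** X) $ 2 $ j = \<omega>\<^sup>2 * X $ 4 $ j" "(C6 ** X) $ 3 $ j = \<omega> * X $ 3 $ j"
  "(C6 ** X) $ 4 $ j = \<omega> * X $ 0 $ j" "(C6 ** X) $ 5 $ j = X $ 5 $ j"
  by (simp_all add: C6_def monomial_matrix_def matrix_matrix_mult_def sum_6)

lemma mult_C6_nth:
  "(X ** C6) $ i $ 0 = \<omega> * X $ i $ 4" "(X ** C6) $ i $ 1 = X $ i $ 1"
  "(X ** C6) $ i $ 2 = X $ i $ 0" "(X ** C6) $ i $ 3 = \<omega> * X $ i $ 3"
  "(X ** C6) $ i $ 4 = \<omega>\<^sup>2 * X $ i $ 2" "(X ** C6) $ i $ 5 = X $ i $ 5"
  by (simp_all add: C6_def mult_monomial_matrix_nth)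

text \<open>Compares the entries at \<open>(i, j - 1)\<close> of the two products. Iterating moves
  every entry along its cyclic diagonal to column 0, where \<open>j \<noteq> 0\<close> stops the
  rewriting.\<close>

lemma A6_commuting_nth:
  assumes "A6 ** X = X ** A6" "j \<noteq> 0"
  shows "X $ i $ j = (if i = 0 then \<omega>\<^sup>2 else 1) * X $ (i - 1) $ (j - 1)"
proof -
  have "inj (\<lambda>j :: 6. j + 1)"
    by (simp add: inj_def)
  then have "(A6 ** X) $ i $ (j - 1) = (if i - 1 = 5 then \<omega>\<^sup>2 else 1) * X $ (i - 1) $ (j - 1)"
    using monomial_matrix_mult_nth [of "\<lambda>j :: 6. j + 1" _ X "i - 1" "j - 1"]
    by (simp add: A6_def)
  moreover have "(X ** A6) $ i $ (j - 1) = X $ i $ j"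
    using assms(2) by (simp add: A6_def mult_monomial_matrix_nth eq_diff_eq diff_eq_eq)
  ultimately show ?thesis
    unfolding assms(1) by (simp add: diff_eq_eq)
qed

text \<open>The centralizer of \<open>A6\<close> consists of the polynomials \<open>\<Sum>k<6. z k * A6 ^ k\<close>, with
  \<open>z k = Z $ k $ 0\<close>. In the application \<open>M\<close> is the inverse of \<open>Z\<close>, hence such a polynomial too, and
  comparing its entries along each cyclic diagonal gives quadratic equations for the \<open>z k\<close>. The
  combinations of entries below come from Gaussian elimination on these equations.\<close>

lemma A6_centralizer_relations:
  assumes Z: "A6 ** Z = Z ** A6"
    and M: "A6 ** M = M ** A6" "M = C6 ** (Z ** (C6 ** Z)) ** C6"
  shows "Z $ 1 $ 0 = 0" "Z $ 3 $ 0 = 0" "Z $ 4 $ 0 = 0" "Z $ 5 $ 0 = 0" "Z $ 0 $ 0 * Z $ 2 $ 0 = 0"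
proof -
  let ?z = "\<lambda>k. Z $ k $ 0"
  have ZCZ: "(Z ** (C6 ** Z)) $ i $ j = Z $ i $ 0 * Z $ 2 $ j + Z $ i $ 1 * Z $ 1 $ j
      + Z $ i $ 2 * (\<omega>\<^sup>2 * Z $ 4 $ j) + Z $ i $ 3 * (\<omega> * Z $ 3 $ j)
      + Z $ i $ 4 * (\<omega> * Z $ 0 $ j) + Z $ i $ 5 * Z $ 5 $ j" for i j
    unfolding matrix_matrix_mult_def [of Z] vec_lambda_beta sum_6 C6_mult_nth ..
  note entries_M = M(2) C6_mult_nth mult_C6_nth ZCZ
  note entries_Z = A6_commuting_nth [OF Z]
  note Mrel = A6_commuting_nth [OF M(1)]
  \<comment> \<open>Each combination of entries of \<open>M\<close> is evaluated twice: expressing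
    \<open>M\<close> through \<open>Z\<close> gives the quadratic expression, while moving the
    entries of \<open>M\<close> to column 0 gives 0.\<close>
  have "9 * (?z 4 * ?z 4) =
        (- 2 + 2 * \<omega>) * M $ 2 $ 0 + (2 - 2 * \<omega>) * M $ 3 $ 1 + (- 1 + \<omega>) * M $ 4 $ 2 +
        (1 + 2 * \<omega>) * M $ 1 $ 5 + (2 + 4 * \<omega>) * M $ 4 $ 0 + (- 3 * \<omega>) * M $ 5 $ 1 +
        (1 - \<omega>) * M $ 2 $ 4 + (- 3) * M $ 0 $ 0 + (4 + 2 * \<omega>) * M $ 1 $ 1 +
        (- 1 - 2 * \<omega>) * M $ 3 $ 3"
    by (simp add: entries_M entries_Z omega_simps algebra_simps)
  also have "\<dots> = 0"
    by (simp add: Mrel omega_simps algebra_simps)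
  finally have r0: "?z 4 * ?z 4 = 0"
    unfolding mult_eq_0_iff by simp
  have "9 * (?z 0 * ?z 2) =
        (1 + 2 * \<omega>) * M $ 2 $ 0 + (- 1 + \<omega>) * M $ 3 $ 1 + (- 1 - 2 * \<omega>) * M $ 4 $ 2 +
        (1 + 2 * \<omega>) * M $ 1 $ 5 + (- 1 - 2 * \<omega>) * M $ 4 $ 0 + (- 3) * M $ 1 $ 3 +
        (1 - \<omega>) * M $ 2 $ 4 + (1 - \<omega>) * M $ 1 $ 1 + (- 3) * M $ 2 $ 2 + (2 + \<omega>) * M $ 3 $ 3"
    by (simp add: entries_M entries_Z omega_simps algebra_simps)
  also have "\<dots> = 0"
    by (simp add: Mrel omega_simps algebra_simps)
  finally have r1: "?z 0 * ?z 2 = 0"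
    unfolding mult_eq_0_iff by simp
  have "9 * (?z 3 * ?z 5) =
        (1 + 2 * \<omega>) * M $ 2 $ 0 + (2 + \<omega>) * M $ 3 $ 1 + (- 1 - 2 * \<omega>) * M $ 4 $ 2 +
        (1 - \<omega>) * M $ 1 $ 5 + (- 1 - 2 * \<omega>) * M $ 4 $ 0 + (- 3) * M $ 1 $ 3 +
        (1 - \<omega>) * M $ 2 $ 4 + (- 2 - \<omega>) * M $ 1 $ 1 + (3 + 3 * \<omega>) * M $ 2 $ 2 +
        (- 1 - 2 * \<omega>) * M $ 3 $ 3"
    by (simp add: entries_M entries_Z omega_simps algebra_simps)
  also have "\<dots> = 0"
    by (simp add: Mrel omega_simps algebra_simps)
  finally have r2: "?z 3 * ?z 5 = 0"
    unfolding mult_eq_0_iff by simp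
  have "9 * (?z 3 * ?z 3 + ?z 5 * ?z 5) =
        (2 + 4 * \<omega>) * M $ 2 $ 0 + (4 + 2 * \<omega>) * M $ 3 $ 1 + (- 2 - 4 * \<omega>) * M $ 4 $ 2 +
        (2 - 2 * \<omega>) * M $ 1 $ 5 + (- 2 - 4 * \<omega>) * M $ 4 $ 0 + 3 * \<omega> * M $ 5 $ 1 +
        (- 1 + \<omega>) * M $ 2 $ 4 + 3 * M $ 0 $ 0 + (- 4 - 2 * \<omega>) * M $ 1 $ 1 +
        (1 + 2 * \<omega>) * M $ 3 $ 3"
    by (simp add: entries_M entries_Z omega_simps algebra_simps)
  also have "\<dots> = 0"
    by (simp add: Mrel omega_simps algebra_simps)
  finally have r3: "?z 3 * ?z 3 + ?z 5 * ?z 5 = 0"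
    unfolding mult_eq_0_iff by simp
  have "9 * (?z 1 * ?z 1 - (1 - \<omega>) * (?z 5 * ?z 5)) =
        (- 2 - 4 * \<omega>) * M $ 2 $ 0 + (- 4 - 2 * \<omega>) * M $ 3 $ 1 + (2 + 4 * \<omega>) * M $ 4 $ 2 +
        (- 2 + 2 * \<omega>) * M $ 1 $ 5 + (2 + 4 * \<omega>) * M $ 4 $ 0 + 6 * M $ 1 $ 3 +
        (- 2 + 2 * \<omega>) * M $ 2 $ 4 + (- 3 + 3 * \<omega>) * M $ 0 $ 0 + (4 + 2 * \<omega>) * M $ 1 $ 1 +
        6 * M $ 2 $ 2 + (- 7 - 5 * \<omega>) * M $ 3 $ 3"
    by (simp add: entries_M entries_Z omega_simps algebra_simps)
  also have "\<dots> = 0"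
    by (simp add: Mrel omega_simps algebra_simps)
  finally have r4: "?z 1 * ?z 1 - (1 - \<omega>) * (?z 5 * ?z 5) = 0"
    unfolding mult_eq_0_iff by simp
  show "?z 4 = 0" "?z 0 * ?z 2 = 0"
    using r0 r1 by simp_all
  \<comment> \<open>By \<open>r2\<close> one of the two vanishes, and then \<open>r3\<close> kills
    the other.\<close>
  show "?z 3 = 0" and z5: "?z 5 = 0"
    using r2 r3 by auto
  then show "?z 1 = 0"
    using r4 by simp
qed

text \<open>A matrix commuting with \<open>A6\<close> is determined by its column 0, in which only
  two entries survive here.\<close>

lemma A6_centralizer_eq:
  assumes Z: "A6 ** Z = Z ** A6"
    and z: "Z $ 1 $ 0 = 0" "Z $ 3 $ 0 = 0" "Z $ 4 $ 0 = 0" "Z $ 5 $ 0 = 0"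
  shows "Z = mat (Z $ 0 $ 0) + mat (Z $ 2 $ 0) ** (A6 ** A6)"
proof -
  have AA: "A6 ** A6 = monomial_matrix (\<lambda>j. j + 2) (\<lambda>j. if j = 4 \<or> j = 5 then \<omega>\<^sup>2 else 1)"
    unfolding A6_def monomial_matrix_mult by (rule monomial_matrix_cong) (simp add: forall_6)
  have neg: "- 2 = (4 :: 6)" "- 3 = (3 :: 6)" "- 4 = (2 :: 6)" "- 5 = (1 :: 6)"
      "9 = (3 :: 6)" "10 = (4 :: 6)" "11 = (5 :: 6)"
    by (simp_all add: eq_neg_iff_add_eq_0 neg_eq_iff_add_eq_0 eq_iff_diff_eq_0 [of "numeral _"])
  show ?thesis
    unfolding vec_eq_iff mat_mult_left AA
    by (simp add: forall_6 A6_commuting_nth [OF Z] z neg mat_def monomial_matrix_def omega_simps algebra_simps)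
qed

text \<open>The centralizer relations leave \<open>D\<close> as a multiple of \<open>C6\<close> or
  of \<open>C6 ** (A6 ** A6)\<close>. The cube condition makes the factor a cube root of unity,
  which the trace condition rules out.\<close>

lemma centralizer_trace_obstruction:
  assumes D: "D ** (D ** D) = mat 1" "trace D = trace (D ** D)"
    and comm: "A6 ** (C6 ** (C6 ** D)) = (C6 ** (C6 ** D)) ** A6"
  shows False
proof -
  \<comment> \<open>\<open>Z\<close> is C6^-1 D and \<open>M\<close> is its inverse D^-1 C6, both
    with inverses written as squares.\<close>
  define Z where "Z = C6 ** (C6 ** D)"
  define M where "M = D ** (D ** C6)"
  have C3: "C6 ** (C6 ** (C6 ** X)) = X" and D3: "D ** (D ** (D ** X)) = X" for X
    by (metis C6_cubed D(1) matrix_mul_assoc matrix_mul_lid)+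
  have CZ: "C6 ** Z = D"
    by (simp only: Z_def C3)
  have Z: "A6 ** Z = Z ** A6"
    using comm by (simp only: Z_def)
  have ZM: "Z ** M = mat 1"
    by (simp only: Z_def M_def matrix_mul_assoc [symmetric] D3 C6_cubed)
  then have MZ: "M ** Z = mat 1"
    by (rule matrix_left_right_inverse1)
  have "A6 ** M = (M ** Z) ** (A6 ** M)"
    by (simp only: MZ matrix_mul_lid)
  also have "\<dots> = M ** ((Z ** A6) ** M)"
    by (simp only: matrix_mul_assoc)
  also have "\<dots> = (M ** A6) ** (Z ** M)"
    by (simp only: Z [symmetric] matrix_mul_assoc)
  finally have M: "A6 ** M = M ** A6"
    by (simp only: ZM matrix_mul_rid)
  have "M = (C6 ** Z) ** ((C6 ** Z) ** C6)"
    by (simp only: CZ M_def)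
  then have "M = C6 ** (Z ** (C6 ** Z)) ** C6"
    by (simp only: matrix_mul_assoc)
  note z = A6_centralizer_relations [OF Z M this]
  define a where "a = Z $ 0 $ 0"
  define b where "b = Z $ 2 $ 0"
  have Z_eq: "Z = mat a + mat b ** (A6 ** A6)"
    unfolding a_def b_def by (rule A6_centralizer_eq [OF Z z(1-4)])
  have ab: "a = 0 \<or> b = 0"
    using z(5) by (simp add: a_def b_def)
  \<comment> \<open>The trace condition makes \<open>x\<close> the quotient of 2 +
    \<open>\<omega>\<close> and 1 - \<open>\<omega>\<close> in one of the two orders, but the cube
    of that quotient is -1.\<close>
  have contra: False
    if "x ^ 3 = 1" "x * (2 + \<omega>) = x\<^sup>2 * (1 - \<omega>) \<or> x * (1 - \<omega>) = x\<^sup>2 * (2 + \<omega>)" for x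
  proof -
    have "x \<noteq> 0"
      using that(1) by auto
    then have "2 + \<omega> = x * (1 - \<omega>) \<or> 1 - \<omega> = x * (2 + \<omega>)"
      using that(2) by (simp add: power2_eq_square)
    then have "(2 + \<omega>) ^ 3 = (1 - \<omega>) ^ 3"
      using that(1) by (metis mult_1 power_mult_distrib)
    moreover have "(2 + \<omega>) ^ 3 = 3 + 6 * \<omega>" "(1 - \<omega>) ^ 3 = - 3 - 6 * \<omega>"
      by (simp_all add: power3_eq_cube omega_simps algebra_simps)
    ultimately show False
      by (simp add: \<omega>_def complex_eq_iff)
  qed
  have sq: "(mat k ** X) ** (mat k ** X) = mat (k * k) ** (X ** X)" for k and X :: "complex ^ 6 ^ 6"
    by (metis mat_commute mat_mult_mat matrix_mul_assoc)
  have tr: "trace (mat k ** X) = k * trace X" for k and X :: "complex ^ 6 ^ 6"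
    by (simp add: trace_def mat_mult_left sum_distrib_left)
  from ab show False
  proof
    assume "b = 0"
    then have D_eq: "D = mat a ** C6"
      unfolding CZ [symmetric] Z_eq by (simp add: mat_commute)
    have "mat (a ^ 3) = (mat 1 :: complex ^ 6 ^ 6)"
      using D(1) unfolding D_eq mat_mult_cubed C6_cubed by simp
    from arg_cong [OF this, of "\<lambda>X. X $ 0 $ 0"] have "a ^ 3 = 1"
      by (simp add: mat_def)
    moreover have "trace C6 = 2 + \<omega>" "trace (C6 ** C6) = 1 - \<omega>"
      unfolding C6_def monomial_matrix_mult trace_monomial_matrix
      by (simp_all add: sum_6 omega_simps algebra_simps)
    then have "a * (2 + \<omega>) = a\<^sup>2 * (1 - \<omega>)"
      using D(2) unfolding D_eq sq tr by (simp add: power2_eq_square)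
    ultimately show False
      using contra by blast
  next
    assume "a = 0"
    let ?F = "C6 ** (A6 ** A6)"
    have D_eq: "D = mat b ** ?F"
      unfolding CZ [symmetric] Z_eq using \<open>a = 0\<close> by (simp add: mat_commute matrix_mul_assoc)
    have F: "?F = monomial_matrix
        (\<lambda>j. if j = 2 then 2 else if j = 4 then 4 else if j = 0 then 0 else j + 2)
        (\<lambda>j. if j = 1 then \<omega> else if j = 2 \<or> j = 5 then \<omega>\<^sup>2 else 1)"
      unfolding C6_def A6_def monomial_matrix_mult
      by (rule monomial_matrix_cong) (simp add: forall_6 omega_simps algebra_simps)
    \<comment> \<open>\<open>?F\<close> fixes the basis vector with index 0, so this single entry
      already determines the cube of \<open>b\<close>.\<close>
    have "(?F ** (?F ** ?F)) $ 0 $ 0 = 1"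
      unfolding F monomial_matrix_mult by (simp add: monomial_matrix_def)
    then have "(mat (b ^ 3) ** (?F ** (?F ** ?F))) $ 0 $ 0 = b ^ 3"
      by (simp add: mat_mult_left)
    moreover have "mat (b ^ 3) ** (?F ** (?F ** ?F)) = mat 1"
      using D(1) unfolding D_eq mat_mult_cubed .
    ultimately have "b ^ 3 = 1"
      by (simp add: mat_def)
    moreover have "trace ?F = 1 - \<omega>" "trace (?F ** ?F) = 2 + \<omega>"
      unfolding F monomial_matrix_mult trace_monomial_matrix
      by (simp_all add: sum_6 omega_simps algebra_simps)
    then have "b * (1 - \<omega>) = b\<^sup>2 * (2 + \<omega>)"
      using D(2) unfolding D_eq sq tr by (simp add: power2_eq_square)
    ultimately show False
      using contra by blast
  qed
qed

text \<open>For D = S T, the relations among \<open>S\<close> and \<open>T\<close> give D^2 = T S.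
  Hence D^3 = 1, and D and D^2 have equal trace.\<close>

lemma A6_B6_no_loop_matrices:
  assumes "S ** S = mat 1" "T ** T = mat 1" "S ** (T ** S) = T ** (S ** T)"
    "S ** (T ** A6) = B6 ** (S ** T)"
  shows False
proof (rule centralizer_trace_obstruction)
  let ?D = "S ** T"
  have D2: "?D ** ?D = T ** S"
  proof -
    have "?D ** ?D = (S ** (T ** S)) ** T"
      by (simp only: matrix_mul_assoc)
    also have "\<dots> = (T ** S) ** (T ** T)"
      unfolding assms(3) by (simp only: matrix_mul_assoc)
    finally show ?thesis
      by (simp only: assms(2) matrix_mul_rid)
  qed
  have "S ** T ** (T ** S) = S ** ((T ** T) ** S)"
    by (simp only: matrix_mul_assoc)
  then show "?D ** (?D ** ?D) = mat 1"
    unfolding D2 by (simp only: assms(1,2) matrix_mul_lid)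
  show "trace ?D = trace (?D ** ?D)"
    unfolding D2 by (rule trace_mul_sym)
  \<comment> \<open>Conjugation by \<open>C6\<close> takes \<open>A6\<close> to \<open>B6\<close>,
    and so does conjugation by \<open>?D\<close> according to the mixed relation; therefore C6^-1 D
    commutes with \<open>A6\<close>.\<close>
  have "C6 ** (C6 ** B6) = A6 ** (C6 ** C6)"
    unfolding A6_def B6_def C6_def monomial_matrix_mult
    by (rule monomial_matrix_cong) (simp add: forall_6 omega_simps algebra_simps)
  then show "A6 ** (C6 ** (C6 ** ?D)) = C6 ** (C6 ** ?D) ** A6"
    using assms(4) by (metis matrix_mul_assoc)
qed

section \<open>The six-dimensional representation is irreducible\<close>

text \<open>The vector obtained from \<open>v\<close> by restricting to the positions \<open>i\<close> with \<open>d i = c\<close> is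
  \<open>(v + c\<^sup>-\<^sup>1 K v + c\<^sup>-\<^sup>2 K\<^sup>2 v) / 3\<close> for the diagonal matrix \<open>K\<close> of the \<open>d i\<close>.\<close>

lemma subspace_restrict_diagonal:
  fixes v :: "complex ^ 'n"
  assumes W: "vec.subspace W"
    and inv: "\<And>v. v \<in> W \<Longrightarrow> monomial_matrix (\<lambda>j. j) d *v v \<in> W"
    and d: "\<And>i. d i ^ 3 = 1" and c: "c ^ 3 = 1" and v: "v \<in> W"
  shows "(\<chi> i. if d i = c then v $ i else 0) \<in> W"
proof -
  let ?K = "monomial_matrix (\<lambda>j. j) d"
  have K: "(?K *v x) $ i = d i * x $ i" for x i
    using monomial_matrix_vector_nth [of "\<lambda>j. j" d x i] by simp
  have "(1 / 3) *s (v + c\<^sup>2 *s (?K *v v) + c *s (?K *v (?K *v v))) \<in> W"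
    by (intro vec.subspace_scale [OF W] vec.subspace_add [OF W] inv v)
  moreover have "(1 / 3) * (v $ i + c\<^sup>2 * (d i * v $ i) + c * (d i * (d i * v $ i)))
      = (if d i = c then v $ i else 0)" for i
  proof -
    \<comment> \<open>This is \<open>d i / c\<close>, a cube root of unity, so 1 + t + t^2 is 3 or 0
      according to whether \<open>d i = c\<close>.\<close>
    let ?t = "c\<^sup>2 * d i"
    have t3: "?t ^ 3 = 1"
    proof -
      have "(c\<^sup>2) ^ 3 = (c ^ 3)\<^sup>2"
        by (simp only: power_mult [symmetric] mult.commute)
      then show ?thesis
        by (simp add: power_mult_distrib c d)
    qed
    have t2: "?t\<^sup>2 = c * (d i)\<^sup>2"
    proof -
      have "?t\<^sup>2 = c ^ 3 * (c * (d i)\<^sup>2)"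
        by (simp add: power2_eq_square power3_eq_cube)
      then show ?thesis
        by (simp only: c mult_1)
    qed
    have "c * ?t = c ^ 3 * d i"
      by (simp add: power2_eq_square power3_eq_cube)
    then have ct: "c * ?t = d i"
      by (simp only: c mult_1)
    have "(1 / 3) * (v $ i + c\<^sup>2 * (d i * v $ i) + c * (d i * (d i * v $ i)))
        = (1 + ?t + ?t\<^sup>2) * v $ i / 3"
      unfolding t2 by (simp add: power2_eq_square algebra_simps)
    also have "\<dots> = (if d i = c then v $ i else 0)"
    proof (cases "?t = 1")
      case True
      then have "d i = c"
        using ct by simp
      then show ?thesis
        unfolding True by simp
    next
      case False
      then have "d i \<noteq> c"
        using c by (auto simp: power2_eq_square power3_eq_cube)
      then show ?thesis
        unfolding cube_root_of_unity_sum [OF t3 False] by simp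
    qed
    finally show ?thesis .
  qed
  note eq = this
  have "(1 / 3) *s (v + c\<^sup>2 *s (?K *v v) + c *s (?K *v (?K *v v)))
      = (\<chi> i. if d i = c then v $ i else 0)"
    by (simp only: vec_eq_iff vector_smult_component vector_add_component K vec_lambda_beta eq simp_thms)
  ultimately show ?thesis
    by simp
qed

text \<open>\<open>d6\<close> and \<open>d6'\<close> are the diagonals of two products of
  \<open>A6\<close> and \<open>C6\<close>; neither separates the six indices alone, but the pair
  does.\<close>

definition d6 :: "6 \<Rightarrow> complex" where
  "d6 j = (if j = 0 \<or> j = 3 then 1 else if j = 1 \<or> j = 2 then \<omega> else \<omega>\<^sup>2)"

definition d6' :: "6 \<Rightarrow> complex" where
  "d6' j = (if j = 2 \<or> j = 3 then 1 else if j = 0 \<or> j = 5 then \<omega> else \<omega>\<^sup>2)"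

text \<open>In \<open>K\<close> the index permutations cancel. The sixth power of \<open>A6\<close>
  is a scalar, so \<open>P\<close> is a multiple of the inverse of \<open>A6\<close>, and the second
  product is a multiple of a conjugate of \<open>K\<close>, with its diagonal shifted by one
  place.\<close>

lemma diagonal_words:
  fixes P K :: "complex ^ 6 ^ 6"
  defines "P \<equiv> A6 ** (A6 ** (A6 ** (A6 ** A6)))"
  defines "K \<equiv> (C6 ** P) ** (C6 ** (A6 ** (A6 ** A6)))"
  shows "K = monomial_matrix (\<lambda>j. j) d6" "A6 ** (K ** P) = monomial_matrix (\<lambda>j. j) d6'"
proof -
  note cong = monomial_matrix_cong
  have P: "P = monomial_matrix (\<lambda>j. j + 5) (\<lambda>j. if j = 0 then 1 else \<omega>\<^sup>2)"
    unfolding P_def A6_def monomial_matrix_mult by (rule cong) (simp add: forall_6)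
  have CP: "C6 ** P = monomial_matrix
      (\<lambda>j. if j = 1 then 4 else if j = 3 then 0 else if j = 5 then 2 else j + 5)
      (\<lambda>j. if j = 2 \<or> j = 3 then \<omega>\<^sup>2 else if j = 5 then \<omega> else 1)"
    unfolding P C6_def monomial_matrix_mult
    by (rule cong) (simp add: forall_6 omega_simps algebra_simps)
  have CAAA: "C6 ** (A6 ** (A6 ** A6)) = monomial_matrix
      (\<lambda>j. if j = 1 then 2 else if j = 3 then 4 else if j = 5 then 0 else j + 3)
      (\<lambda>j. if j = 0 then \<omega> else if j = 2 \<or> j = 3 then 1 else \<omega>\<^sup>2)"
    unfolding A6_def C6_def monomial_matrix_mult
    by (rule cong) (simp add: forall_6 omega_simps algebra_simps)
  show K: "K = monomial_matrix (\<lambda>j. j) d6"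
    unfolding K_def CP CAAA monomial_matrix_mult d6_def
    by (rule cong) (simp add: forall_6 omega_simps algebra_simps)
  show "A6 ** (K ** P) = monomial_matrix (\<lambda>j. j) d6'"
    unfolding K P A6_def monomial_matrix_mult d6_def d6'_def
    by (rule cong) (simp add: forall_6 omega_simps algebra_simps)
qed

lemma d6_pair_inj: "\<forall>i j. d6 i = d6 j \<and> d6' i = d6' j \<longrightarrow> i = j"
proof -
  have "\<omega>\<^sup>2 \<noteq> 1" "\<omega>\<^sup>2 \<noteq> \<omega>"
    unfolding omega_simps by (simp_all add: \<omega>_def complex_eq_iff)
  then show ?thesis
    using omega_neq(2) unfolding forall_6 d6_def d6'_def by (simp add: eq_commute [of 1] eq_commute [of \<omega> "\<omega>\<^sup>2"])
qed

text \<open>The two diagonal matrices isolate one basis vector inside any nonzero invariant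
  subspace; \<open>A6\<close> carries it around the cycle to all the others, up to nonzero
  factors.\<close>

lemma irreducible_pair_A6_B6: "irreducible_pair A6 B6"
  unfolding irreducible_pair_def
proof (intro allI impI, elim conjE)
  fix W :: "(complex ^ 6) set"
  assume W: "vec.subspace W" and inv: "\<forall>w\<in>W. A6 *v w \<in> W \<and> B6 *v w \<in> W"
  let ?inv = "\<lambda>M. \<forall>w\<in>W. M *v w \<in> W"
  have A: "?inv A6" and B: "?inv B6"
    using inv by simp_all
  have mult: "?inv (M ** N)" if "?inv M" "?inv N" for M N
    using that by (simp flip: matrix_vector_mul_assoc)
  have C: "?inv C6"
    using mult [OF A B] by (simp only: A6_B6)
  have d6: "?inv (monomial_matrix (\<lambda>j. j) d6)" and d6': "?inv (monomial_matrix (\<lambda>j. j) d6')"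
    unfolding diagonal_words [symmetric] by (intro mult A C)+
  have cubes: "d6 i ^ 3 = 1" "d6' i ^ 3 = 1" for i
    by (simp_all add: d6_def d6'_def power3_eq_cube omega_simps algebra_simps)
  show "W = {0} \<or> W = UNIV"
  proof (cases "W = {0}")
    case False
    then obtain v where v: "v \<in> W" "v \<noteq> 0"
      using vec.subspace_0 [OF W] by blast
    then obtain i where i: "v $ i \<noteq> 0"
      by (auto simp: vec_eq_iff)
    \<comment> \<open>Restricting by \<open>d6\<close> keeps only the coordinates sharing its value
      at \<open>i\<close>; restricting further by \<open>d6'\<close> leaves coordinate
      \<open>i\<close> alone.\<close>
    let ?u = "\<chi> j. if d6 j = d6 i then v $ j else 0"
    have "?u \<in> W"
      using d6 by (intro subspace_restrict_diagonal [OF W _ cubes(1) cubes(1) v(1)]) (rule bspec)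
    then have "(\<chi> j. if d6' j = d6' i then ?u $ j else 0) \<in> W"
      using d6' by (intro subspace_restrict_diagonal [OF W _ cubes(2) cubes(2)]) (rule bspec)
    moreover have "(\<chi> j. if d6' j = d6' i then ?u $ j else 0) = v $ i *s axis i 1"
      using d6_pair_inj by (auto simp: vec_eq_iff axis_def)
    ultimately have "v $ i *s axis i 1 \<in> W"
      by (simp only:)
    then have "(1 / v $ i) *s (v $ i *s axis i 1) \<in> W"
      by (rule vec.subspace_scale [OF W])
    then have i_in: "axis i 1 \<in> W"
      using i by simp
    have step: "axis (j + 1) 1 \<in> W" if "axis j 1 \<in> W" for j
    proof -
      let ?c = "if j = 5 then \<omega>\<^sup>2 else 1"
      have "A6 *v axis j 1 = ?c *s axis (j + 1) 1"
      proof -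
        have "(A6 *v x) $ k = (if k - 1 = 5 then \<omega>\<^sup>2 else 1) * x $ (k - 1)" for x k
          using monomial_matrix_vector_nth [of "\<lambda>j :: 6. j + 1" _ x "k - 1"]
          by (simp add: A6_def inj_def)
        moreover have "j + 1 = 0 \<longleftrightarrow> j = 5"
          unfolding eq_neg_iff_add_eq_0 [symmetric] numeral_6(2) ..
        ultimately show ?thesis
          by (auto simp: vec_eq_iff axis_def diff_eq_eq)
      qed
      then have "?c *s axis (j + 1) 1 \<in> W"
        using bspec [OF A that] by (simp only:)
      then have "(1 / ?c) *s (?c *s axis (j + 1) 1) \<in> W"
        by (rule vec.subspace_scale [OF W])
      then show ?thesis
        by (simp split: if_splits)
    qed
    have "axis (i + of_nat n) 1 \<in> W" for n
    proof (induction n)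
      case (Suc n)
      then show ?case
        using step [of "i + of_nat n"] by (simp add: algebra_simps)
    qed (simp add: i_in)
    moreover have "\<exists>n. j - i = of_nat n" for j
      using exhaust_6 [of "j - i"] by (metis of_nat_0 of_nat_1 of_nat_numeral)
    ultimately have "axis (i + (j - i)) 1 \<in> W" for j
      by metis
    then have "axis j 1 \<in> W" for j
      by simp
    then have "(\<Sum>j\<in>UNIV. x $ j *s axis j 1) \<in> W" for x
      by (intro vec.subspace_sum [OF W] vec.subspace_scale [OF W])
    then have "W = UNIV"
      by (auto simp: basis_expansion)
    then show ?thesis ..
  qed simp
qed

theorem irreducible_rep_without_extension:
  "\<exists>\<rho> :: braid_gen gword set \<Rightarrow> complex ^ 6 ^ 6.
     irreducible_rep B3 \<rho> \<and> \<not> (\<exists>\<rho>'. is_extension \<rho> \<rho>')"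
proof -
  obtain \<rho> where \<rho>: "representation B3 \<rho>" "\<rho> (B3_gen BSigma1) = A6" "\<rho> (B3_gen BSigma2) = B6"
    by (rule representation_B3_exists [OF invertible_A6_B6 A6_B6_braid])
  have "irreducible_rep B3 \<rho>"
    using irreducible_pair_A6_B6 by (simp only: irreducible_rep_B3_iff [OF \<rho>(1)] \<rho>)
  moreover have "\<not> (\<exists>\<rho>'. is_extension \<rho> \<rho>')"
    unfolding extension_exists_iff [OF \<rho>(1)] \<rho>(2,3)
    by (intro notI) (elim exE conjE, rule A6_B6_no_loop_matrices)
  ultimately show ?thesis
    by blast
qed

theorem mainTheorem1:
  shows "(CARD('n::finite) \<le> 5 \<longrightarrow>
            (\<forall>\<rho> :: braid_gen gword set \<Rightarrow> complex ^ 'n ^ 'n.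
               irreducible_rep B3 \<rho> \<longrightarrow> (\<exists>\<rho>'. is_extension \<rho> \<rho>')))
       \<and> (\<exists>\<rho> :: braid_gen gword set \<Rightarrow> complex ^ 6 ^ 6.
            irreducible_rep B3 \<rho> \<and> \<not> (\<exists>\<rho>'. is_extension \<rho> \<rho>'))"
  using extension_exists_of_dim_le_5 irreducible_rep_without_extension by blast

end
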